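(* Let $1<p<\infty$, let $a,b$ be as in the context, and let $w=(w_n)_{n\ge0}$ be a sequence of nonzero complex numbers such that $F_w$ is a bounded operator on $\ell^p_{a,b}$. Then: (i) If for every $\nu\ge0$ $$\liminf_{n\to\infty}\frac{|a_{\nu+n}|+|b_{\nu+n-1}|}{\prod_{k=0}^{n-1}|w_{\nu+k}|}=0,$$ then $F_w^*$ is hypercyclic on $(\ell^p_{a,b})^*$. (ii) If $F_w^*$ is hypercyclic on $(\ell^p_{a,b})^*$ and the constant function $1$ belongs to $\ell^p_{a,b}$, then $$\sup_{n\ge0}\frac{\prod_{k=0}^{n-1}|w_k|}{|a_n|}\Big(1+\sum_{j=1}^{\infty}\Big|\prod_{k=0}^{j-1}\frac{b_{n+k}}{a_{n+k+1}}\Big|^p\Big)^{1/p}=\infty.$$ (iii) $F_w^*$ is supercyclic on $(\ell^p_{a,b})^*$. (iv) If $\sup_{n\ge0}|w_na_n/a_{n+1}|<\infty$ and $\limsup_{n\to\infty}|b_n/a_{n+1}|<1$, then $F_w^*$ is hypercyclic on $(\ell^p_{a,b})^*$ if and only if $$\liminf_{n\to\infty}\Big|\frac{a_{\nu+n}}{\prod_{k=0}^{n-1}w_{\nu+k}}\Big|=0\quad\text{for all }\nu\ge0.$$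
   Context: Let $a=(a_n)_{n\ge0}$, $b=(b_n)_{n\ge0}$ be sequences of nonzero complex numbers with $\limsup_{n\to\infty}(|a_n|+|b_n|)^{1/n}<\infty$, and let $R=1/\limsup_{n}(|a_n|+|b_n|)^{1/n}\in(0,\infty]$. For $n\ge0$ let $f_n(z)=(a_n+b_nz)z^n$. For $1\le p<\infty$, $\ell^p_{a,b}$ is the space of analytic functions on $\{|z|<R\}$ of the form $f=\sum_{n\ge0}\lambda_nf_n$ with $(\lambda_n)\in\ell^p(\mathbb{N}_0)$ (the series converges locally uniformly on $\{|z|<R\}$ and the $\lambda_n$ are uniquely determined by $f$), normed by $\|f\|=(\sum_n|\lambda_n|^p)^{1/p}$; thus $\{f_n\}$ is a normalized Schauder basis equivalent to the standard basis of $\ell^p(\mathbb{N}_0)$. For a sequence $w=(w_n)_{n\ge0}$, the weighted forward shift is $F_w\big(\sum_{n\ge0}\mu_nz^n\big)=\sum_{n\ge0}\mu_nw_nz^{n+1}$ (acting on power series); "bounded on $X$" means $F_w$ maps $X$ into $X$ and is a bounded operator; $F_w^*$ is its Banach space adjoint. An operator $T$ on a separable Banach space $Y$ is hypercyclic if some orbit $\{T^nx:n\ge0\}$ is dense in $Y$, and supercyclic if for some $x$ the set $\{cT^nx:c\in\mathbb{C},n\ge0\}$ is dense in $Y$. Empty products equal $1$. *)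

theory Defs
  imports "HOL-Analysis.Analysis" "HOL-Library.Liminf_Limsup"
begin

text \<open>The limsup rho = limsup (|a_n|+|b_n|)^(1/n); R = 1/rho. The disc {|z| < R} is
  described as {z. |z| * rho < 1}.\<close>
definition ab_rho :: "(nat \<Rightarrow> complex) \<Rightarrow> (nat \<Rightarrow> complex) \<Rightarrow> ereal" where
  "ab_rho a b = limsup (\<lambda>n. ereal (root n (cmod (a n) + cmod (b n))))"

definition ab_disc :: "(nat \<Rightarrow> complex) \<Rightarrow> (nat \<Rightarrow> complex) \<Rightarrow> complex set" where
  "ab_disc a b = {z. ereal (cmod z) * ab_rho a b < 1}"

definition fbasis :: "(nat \<Rightarrow> complex) \<Rightarrow> (nat \<Rightarrow> complex) \<Rightarrow> nat \<Rightarrow> complex \<Rightarrow> complex" where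
  "fbasis a b n z = (a n + b n * z) * z ^ n"

definition lp_seq :: "real \<Rightarrow> (nat \<Rightarrow> complex) set" where
  "lp_seq p = {l. summable (\<lambda>n. cmod (l n) powr p)}"

text \<open>f = sum_n l_n f_n on the disc; functions are normalised to be 0 off the disc.\<close>
definition ab_represents ::
  "(nat \<Rightarrow> complex) \<Rightarrow> (nat \<Rightarrow> complex) \<Rightarrow> (nat \<Rightarrow> complex) \<Rightarrow> (complex \<Rightarrow> complex) \<Rightarrow> bool" where
  "ab_represents a b l f \<longleftrightarrow>
     (\<forall>z\<in>ab_disc a b. (\<lambda>n. l n * fbasis a b n z) sums f z) \<and> (\<forall>z. z \<notin> ab_disc a b \<longrightarrow> f z = 0)"

definition lpab :: "real \<Rightarrow> (nat \<Rightarrow> complex) \<Rightarrow> (nat \<Rightarrow> complex) \<Rightarrow> (complex \<Rightarrow> complex) set" where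
  "lpab p a b = {f. \<exists>l\<in>lp_seq p. ab_represents a b l f}"

definition lpab_coef ::
  "real \<Rightarrow> (nat \<Rightarrow> complex) \<Rightarrow> (nat \<Rightarrow> complex) \<Rightarrow> (complex \<Rightarrow> complex) \<Rightarrow> nat \<Rightarrow> complex" where
  "lpab_coef p a b f = (THE l. l \<in> lp_seq p \<and> ab_represents a b l f)"

definition lpab_norm :: "real \<Rightarrow> (nat \<Rightarrow> complex) \<Rightarrow> (nat \<Rightarrow> complex) \<Rightarrow> (complex \<Rightarrow> complex) \<Rightarrow> real" where
  "lpab_norm p a b f = (\<Sum>n. cmod (lpab_coef p a b f n) powr p) powr (1 / p)"

definition taylor_coef :: "(complex \<Rightarrow> complex) \<Rightarrow> nat \<Rightarrow> complex" where
  "taylor_coef f n = (deriv ^^ n) f 0 / of_nat (fact n)"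

definition fshift ::
  "(nat \<Rightarrow> complex) \<Rightarrow> (nat \<Rightarrow> complex) \<Rightarrow> (nat \<Rightarrow> complex) \<Rightarrow> (complex \<Rightarrow> complex) \<Rightarrow> complex \<Rightarrow> complex" where
  "fshift a b w f = (\<lambda>z. if z \<in> ab_disc a b then (\<Sum>n. taylor_coef f n * w n * z ^ Suc n) else 0)"

definition fshift_bounded :: "real \<Rightarrow> (nat \<Rightarrow> complex) \<Rightarrow> (nat \<Rightarrow> complex) \<Rightarrow> (nat \<Rightarrow> complex) \<Rightarrow> bool" where
  "fshift_bounded p a b w \<longleftrightarrow>
     (\<forall>f\<in>lpab p a b. (\<forall>z\<in>ab_disc a b. summable (\<lambda>n. taylor_coef f n * w n * z ^ Suc n))
                       \<and> fshift a b w f \<in> lpab p a b)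
     \<and> (\<exists>C. \<forall>f\<in>lpab p a b. lpab_norm p a b (fshift a b w f) \<le> C * lpab_norm p a b f)"

text \<open>The dual space: bounded linear functionals on l^p_{a,b} (normalised to 0 off the space).\<close>
definition lpab_dual ::
  "real \<Rightarrow> (nat \<Rightarrow> complex) \<Rightarrow> (nat \<Rightarrow> complex) \<Rightarrow> ((complex \<Rightarrow> complex) \<Rightarrow> complex) set" where
  "lpab_dual p a b = {\<phi>.
     (\<forall>f\<in>lpab p a b. \<forall>g\<in>lpab p a b. \<phi> (\<lambda>z. f z + g z) = \<phi> f + \<phi> g)
   \<and> (\<forall>c. \<forall>f\<in>lpab p a b. \<phi> (\<lambda>z. c * f z) = c * \<phi> f)
   \<and> (\<exists>C. \<forall>f\<in>lpab p a b. cmod (\<phi> f) \<le> C * lpab_norm p a b f)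
   \<and> (\<forall>f. f \<notin> lpab p a b \<longrightarrow> \<phi> f = 0)}"

definition dual_norm ::
  "real \<Rightarrow> (nat \<Rightarrow> complex) \<Rightarrow> (nat \<Rightarrow> complex) \<Rightarrow> ((complex \<Rightarrow> complex) \<Rightarrow> complex) \<Rightarrow> real" where
  "dual_norm p a b \<phi> = (SUP f\<in>{f\<in>lpab p a b. lpab_norm p a b f \<le> 1}. cmod (\<phi> f))"

definition fshift_adj ::
  "real \<Rightarrow> (nat \<Rightarrow> complex) \<Rightarrow> (nat \<Rightarrow> complex) \<Rightarrow> (nat \<Rightarrow> complex)
     \<Rightarrow> ((complex \<Rightarrow> complex) \<Rightarrow> complex) \<Rightarrow> (complex \<Rightarrow> complex) \<Rightarrow> complex" where
  "fshift_adj p a b w \<phi> = (\<lambda>f. if f \<in> lpab p a b then \<phi> (fshift a b w f) else 0)"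

definition hypercyclic_on :: "'x set \<Rightarrow> ('x \<Rightarrow> 'x \<Rightarrow> real) \<Rightarrow> ('x \<Rightarrow> 'x) \<Rightarrow> bool" where
  "hypercyclic_on S d T \<longleftrightarrow> (\<exists>x\<in>S. \<forall>y\<in>S. \<forall>e>0. \<exists>n. d ((T ^^ n) x) y < e)"

definition dual_dist ::
  "real \<Rightarrow> (nat \<Rightarrow> complex) \<Rightarrow> (nat \<Rightarrow> complex)
     \<Rightarrow> ((complex \<Rightarrow> complex) \<Rightarrow> complex) \<Rightarrow> ((complex \<Rightarrow> complex) \<Rightarrow> complex) \<Rightarrow> real" where
  "dual_dist p a b \<phi> \<psi> = dual_norm p a b (\<lambda>f. \<phi> f - \<psi> f)"

definition adj_hypercyclic :: "real \<Rightarrow> (nat \<Rightarrow> complex) \<Rightarrow> (nat \<Rightarrow> complex) \<Rightarrow> (nat \<Rightarrow> complex) \<Rightarrow> bool" where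
  "adj_hypercyclic p a b w \<longleftrightarrow> hypercyclic_on (lpab_dual p a b) (dual_dist p a b) (fshift_adj p a b w)"

definition adj_supercyclic :: "real \<Rightarrow> (nat \<Rightarrow> complex) \<Rightarrow> (nat \<Rightarrow> complex) \<Rightarrow> (nat \<Rightarrow> complex) \<Rightarrow> bool" where
  "adj_supercyclic p a b w \<longleftrightarrow>
     (\<exists>\<phi>\<in>lpab_dual p a b. \<forall>\<psi>\<in>lpab_dual p a b. \<forall>e>0. \<exists>n. \<exists>c::complex.
        dual_dist p a b (\<lambda>f. c * (fshift_adj p a b w ^^ n) \<phi> f) \<psi> < e)"

end

theory Submission
  imports Defs
begin

text \<open>
  Let \<open>\<kappa>\<^sub>n\<close> be the functional taking the \<open>n\<close>-th Taylor coefficient. The adjoint \<open>T\<close> of the shift sends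
  \<open>\<kappa>\<^sub>n\<^sub>+\<^sub>1\<close> to \<open>w\<^sub>n \<kappa>\<^sub>n\<close> and kills \<open>\<kappa>\<^sub>0\<close>, the norm of \<open>\<kappa>\<^sub>n\<close> is at most \<open>\<bar>a\<^sub>n\<bar> + \<bar>b\<^sub>n\<^sub>-\<^sub>1\<bar>\<close>, and
  the \<open>\<kappa>\<^sub>n\<close> span the coordinate functionals, hence (as \<open>p > 1\<close>) a dense subspace of the dual.
  A (super- or) hypercyclic functional is a series \<open>\<Sum>v\<^sub>j\<close> of finite combinations of the \<open>\<kappa>\<^sub>n\<close> with
  \<open>T ^^ n\<^sub>j\<close> mapping \<open>v\<^sub>j\<close> to \<open>c\<^sub>j y\<^sub>j\<close>, where \<open>y\<^sub>j\<close> runs through a countable dense set: \<open>T ^^ n\<^sub>j\<close> kills the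
  earlier terms if \<open>n\<^sub>j\<close> is large, and the later terms are chosen small. For supercyclicity smallness
  is free because of the scalars \<open>c\<^sub>j\<close>; for hypercyclicity \<open>c\<^sub>j = 1\<close> and it is the liminf condition.
  Summing the series pointwise makes completeness of the dual unnecessary.

  Conversely, if \<open>T\<close> is hypercyclic, then the orbit of every nonzero \<open>f\<close> under the shift is unbounded;
  for a monomial \<open>f\<close> the norms along the orbit are explicit.
\<close>

section \<open>The sequence space l^p and its norm\<close>

lemma lp_seq_mono:
  assumes "l \<in> lp_seq p" "0 < p" "\<And>n. cmod (m n) \<le> cmod (l n)"
  shows "m \<in> lp_seq p"
proof -
  have "summable (\<lambda>n. cmod (m n) powr p)"
    by (rule summable_comparison_test'[of "\<lambda>n. cmod (l n) powr p" 0])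
      (use assms in \<open>auto simp: lp_seq_def powr_mono2\<close>)
  then show ?thesis by (simp add: lp_seq_def)
qed

lemma lp_seq_scale:
  assumes "l \<in> lp_seq p"
  shows "(\<lambda>n. c * l n) \<in> lp_seq p"
  using assms by (simp add: lp_seq_def norm_mult powr_mult summable_mult)

lemma lp_seq_add:
  assumes "l \<in> lp_seq p" "m \<in> lp_seq p" "0 < p"
  shows "(\<lambda>n. l n + m n) \<in> lp_seq p"
proof -
  have bound: "cmod (l n + m n) powr p \<le> 2 powr p * (cmod (l n) powr p + cmod (m n) powr p)" for n
  proof -
    have "cmod (l n + m n) \<le> 2 * max (cmod (l n)) (cmod (m n))"
      using norm_triangle_ineq[of "l n" "m n"] by linarith
    then have "cmod (l n + m n) powr p \<le> (2 * max (cmod (l n)) (cmod (m n))) powr p"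
      using assms(3) by (intro powr_mono2) auto
    also have "\<dots> = 2 powr p * max (cmod (l n)) (cmod (m n)) powr p"
      by (simp add: powr_mult)
    also have "\<dots> \<le> 2 powr p * (cmod (l n) powr p + cmod (m n) powr p)"
      by (intro mult_left_mono) (auto simp: max_def)
    finally show ?thesis .
  qed
  have "summable (\<lambda>n. 2 powr p * (cmod (l n) powr p + cmod (m n) powr p))"
    using assms by (intro summable_mult summable_add) (auto simp: lp_seq_def)
  then have "summable (\<lambda>n. cmod (l n + m n) powr p)"
    by (rule summable_comparison_test') (use bound in auto)
  then show ?thesis by (simp add: lp_seq_def)
qed

definition lp_norm :: "real \<Rightarrow> (nat \<Rightarrow> complex) \<Rightarrow> real" where
  "lp_norm p l = (\<Sum>n. cmod (l n) powr p) powr (1 / p)"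

lemma lp_norm_nonneg: "0 \<le> lp_norm p l"
  by (simp add: lp_norm_def)

lemma lp_norm_powr:
  assumes "l \<in> lp_seq p" "0 < p"
  shows "lp_norm p l powr p = (\<Sum>n. cmod (l n) powr p)"
  using assms by (auto simp: lp_norm_def powr_powr lp_seq_def suminf_nonneg)

lemma lp_norm_mono:
  assumes "l \<in> lp_seq p" "0 < p" "\<And>n. cmod (m n) \<le> cmod (l n)"
  shows "lp_norm p m \<le> lp_norm p l"
  unfolding lp_norm_def using assms lp_seq_mono[OF assms]
  by (intro powr_mono2 suminf_le suminf_nonneg) (auto simp: lp_seq_def intro: powr_mono2)

lemma lp_norm_scale:
  assumes "l \<in> lp_seq p" "0 < p"
  shows "lp_norm p (\<lambda>n. c * l n) = cmod c * lp_norm p l"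
  using assms
  by (simp add: lp_norm_def lp_seq_def norm_mult powr_mult suminf_mult powr_powr suminf_nonneg)

lemma norm_le_lp_norm:
  assumes "l \<in> lp_seq p" "0 < p"
  shows "cmod (l n) \<le> lp_norm p l"
proof -
  have "(\<Sum>k\<in>{n}. cmod (l k) powr p) \<le> (\<Sum>k. cmod (l k) powr p)"
    using assms by (intro sum_le_suminf) (auto simp: lp_seq_def)
  then have "(cmod (l n) powr p) powr (1 / p) \<le> lp_norm p l"
    unfolding lp_norm_def using assms by (intro powr_mono2) auto
  then show ?thesis using assms by (simp add: powr_powr)
qed

lemma lp_norm_tail_tendsto:
  assumes "l \<in> lp_seq p" "0 < p"
  shows "(\<lambda>N. lp_norm p (\<lambda>n. if n < N then 0 else l n)) \<longlonglongrightarrow> 0"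
proof -
  let ?h = "\<lambda>n. cmod (l n) powr p"
  have summ: "summable ?h" using assms by (simp add: lp_seq_def)
  have eq: "(\<Sum>n. cmod (if n < N then 0 else l n) powr p) = (\<Sum>n. ?h (n + N))" for N
  proof -
    have "summable (\<lambda>n. cmod (if n < N then 0 else l n) powr p)"
      using lp_seq_mono[OF assms, of "\<lambda>n. if n < N then 0 else l n"] by (simp add: lp_seq_def)
    from suminf_split_initial_segment[OF this, of N] show ?thesis by simp
  qed
  have "(\<lambda>N. \<Sum>n. ?h (n + N)) \<longlonglongrightarrow> 0"
    using suminf_exist_split2[OF summ] .
  then have "(\<lambda>N. (\<Sum>n. ?h (n + N)) powr (1 / p)) \<longlonglongrightarrow> 0 powr (1 / p)"
    using assms summ
    by (intro tendsto_powr2) (auto intro!: always_eventually suminf_nonneg summable_ignore_initial_segment)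
  then show ?thesis using assms by (simp add: lp_norm_def eq)
qed

section \<open>Tails of bounded functionals on l^p\<close>

text \<open>On disjoint supports the p-th powers add. Dropping the outer exponent
  \<open>1 / p\<close> is affordable: since \<open>1 < p\<close>, the excess \<open>t powr p\<close>
  is still of smaller order than \<open>t\<close>.\<close>

lemma lp_norm_disjoint_le:
  assumes l: "l \<in> lp_seq p" "lp_norm p l \<le> 1" and m: "m \<in> lp_seq p" "lp_norm p m \<le> 1"
    and p: "1 < p" and t: "0 \<le> t" and disj: "\<And>n. l n = 0 \<or> m n = 0"
  shows "lp_norm p (\<lambda>n. l n + of_real t * m n) \<le> 1 + t powr p"
proof -
  let ?L = "\<Sum>n. cmod (l n) powr p" and ?M = "\<Sum>n. cmod (m n) powr p"
  have eq: "cmod (l n + of_real t * m n) powr p = cmod (l n) powr p + t powr p * cmod (m n) powr p" for n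
    using disj[of n] t p by (auto simp: norm_mult powr_mult)
  have s: "(\<Sum>n. cmod (l n + of_real t * m n) powr p) = ?L + t powr p * ?M"
    unfolding eq using l m
    by (subst suminf_add[symmetric]) (auto simp: lp_seq_def suminf_mult summable_mult)
  have one: "s \<le> 1" if "s = lp_norm p k powr p" "lp_norm p k \<le> 1" for s k
    using that lp_norm_nonneg[of p k] p by (auto intro: powr_le1)
  have "?L \<le> 1" "?M \<le> 1"
    using one[of _ l] one[of _ m] lp_norm_powr[of l p] lp_norm_powr[of m p] l m p by auto
  then have le: "?L + t powr p * ?M \<le> 1 + t powr p"
    using mult_left_mono[of ?M 1 "t powr p"] by simp
  have "0 \<le> ?L + t powr p * ?M"
    using l m by (intro add_nonneg_nonneg mult_nonneg_nonneg suminf_nonneg) (auto simp: lp_seq_def)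
  then have "lp_norm p (\<lambda>n. l n + of_real t * m n) \<le> (1 + t powr p) powr (1 / p)"
    unfolding lp_norm_def s using le p by (intro powr_mono2) auto
  also have "\<dots> \<le> (1 + t powr p) powr 1"
    using p by (intro powr_mono) auto
  finally show ?thesis by simp
qed

text \<open>If a unit vector \<open>l\<close> supported below \<open>M\<close> nearly attains the norm \<open>S\<close> of \<open>L\<close>, then
  \<open>S - \<delta> + t \<bar>L m\<bar> \<le> S (1 + t powr p)\<close> for unit vectors \<open>m\<close> supported beyond \<open>M\<close>; letting \<open>t\<close> be small
  and then \<open>\<delta>\<close> much smaller than \<open>t\<close> avoids Hoelder's inequality and the dual exponent.\<close>
lemma lp_functional_tail_small:
  fixes L :: "(nat \<Rightarrow> complex) \<Rightarrow> complex"
  assumes p: "1 < p" and e: "0 < e"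
    and add: "\<And>l m. l \<in> lp_seq p \<Longrightarrow> m \<in> lp_seq p \<Longrightarrow> L (\<lambda>n. l n + m n) = L l + L m"
    and scale: "\<And>c l. l \<in> lp_seq p \<Longrightarrow> L (\<lambda>n. c * l n) = c * L l"
    and bound: "\<And>l. l \<in> lp_seq p \<Longrightarrow> cmod (L l) \<le> C * lp_norm p l"
  obtains M where "\<And>l. l \<in> lp_seq p \<Longrightarrow> (\<And>n. n < M \<Longrightarrow> l n = 0) \<Longrightarrow> cmod (L l) \<le> e * lp_norm p l"
proof -
  have p0: "0 < p" using p by simp
  define B where "B = {l \<in> lp_seq p. lp_norm p l \<le> 1}"
  define S where "S = (SUP l\<in>B. cmod (L l))"
  have bnd: "cmod (L l) \<le> \<bar>C\<bar> * lp_norm p l" if "l \<in> lp_seq p" for l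
    using bound[OF that] mult_right_mono[OF abs_ge_self[of C] lp_norm_nonneg[of p l]] by linarith
  have B1: "cmod (L l) \<le> \<bar>C\<bar>" if "l \<in> B" for l
    using bnd[of l] that mult_left_mono[of "lp_norm p l" 1 "\<bar>C\<bar>"] by (auto simp: B_def)
  have bdd: "bdd_above ((\<lambda>l. cmod (L l)) ` B)" using B1 by (auto intro!: bdd_aboveI)
  have zB: "(\<lambda>_. 0) \<in> B" using p0 by (simp add: B_def lp_seq_def lp_norm_def)
  have LS: "cmod (L l) \<le> S" if "l \<in> B" for l
    unfolding S_def using that bdd by (rule cSUP_upper)
  have S0: "0 \<le> S" using LS[OF zB] norm_ge_zero order_trans by blast
  \<comment> \<open>Estimates on multiples inside the unit ball extend by homogeneity; sequences of
    norm 0 cannot be normalised and are covered by \<open>bnd\<close>.\<close>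
  have homog: "cmod (L l) \<le> K * lp_norm p l"
    if l: "l \<in> lp_seq p" and K: "\<And>c. (\<lambda>n. c * l n) \<in> B \<Longrightarrow> cmod (L (\<lambda>n. c * l n)) \<le> K" for l K
  proof (cases "lp_norm p l = 0")
    case True
    then show ?thesis using bnd[OF l] by simp
  next
    case False
    then have pos: "0 < lp_norm p l" using lp_norm_nonneg[of p l] by linarith
    let ?c = "of_real (1 / lp_norm p l) :: complex"
    have "(\<lambda>n. ?c * l n) \<in> B"
      unfolding B_def using pos lp_seq_scale[OF l, of ?c] lp_norm_scale[OF l p0, of ?c]
      by (simp add: norm_divide)
    from K[OF this] have "cmod (?c * L l) \<le> K" unfolding scale[OF l] .
    then show ?thesis using pos by (simp add: norm_mult norm_divide field_simps)
  qed
  have LSn: "cmod (L l) \<le> S * lp_norm p l" if "l \<in> lp_seq p" for l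
    using that LS by (rule homog)
  \<comment> \<open>Solves \<open>(S + 1) * t powr (p - 1) = e / 2\<close>, so the excess
    \<open>S * t powr p\<close> costs at most half of \<open>t * e\<close>; \<open>S + 1\<close>
    avoids division by 0.\<close>
  define t where "t = (e / (2 * (S + 1))) powr (1 / (p - 1))"
  have t0: "0 < t" using e S0 by (simp add: t_def)
  have tp: "t powr (p - 1) = e / (2 * (S + 1))"
    using p e S0 by (simp add: t_def powr_powr)
  have "S * t powr (p - 1) \<le> e / 2"
    unfolding tp using S0 e by (simp add: field_simps)
  moreover have tpp: "t powr p = t * t powr (p - 1)"
    using t0 powr_add[of t 1 "p - 1"] by simp
  ultimately have St: "S * t powr p \<le> t * (e / 2)"
    using t0 mult_left_mono[of "S * t powr (p - 1)" "e / 2" t] by (simp add: mult_ac)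
  \<comment> \<open>\<open>d\<close> is lost twice, once because \<open>l0\<close> only nearly
    attains \<open>S\<close> and once by truncating \<open>l0\<close>; together this is the other
    half of \<open>t * e\<close>.\<close>
  define d where "d = t * e / 4"
  have d0: "0 < d" using t0 e by (simp add: d_def)
  have "\<exists>l\<in>B. S - d < cmod (L l)"
    using less_cSUP_iff[of B "\<lambda>l. cmod (L l)" "S - d"] zB bdd d0 by (auto simp: S_def)
  then obtain l0 where l0: "l0 \<in> B" "S - d < cmod (L l0)" by blast
  have l0p: "l0 \<in> lp_seq p" "lp_norm p l0 \<le> 1" using l0(1) by (auto simp: B_def)
  have "(\<lambda>M. \<bar>C\<bar> * lp_norm p (\<lambda>n. if n < M then 0 else l0 n)) \<longlonglongrightarrow> \<bar>C\<bar> * 0"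
    by (intro tendsto_intros lp_norm_tail_tendsto l0p p0)
  then have "eventually (\<lambda>M. \<bar>C\<bar> * lp_norm p (\<lambda>n. if n < M then 0 else l0 n) < d) sequentially"
    using d0 by (intro order_tendstoD(2)[where y = "\<bar>C\<bar> * 0"]) auto
  then obtain M where M: "\<bar>C\<bar> * lp_norm p (\<lambda>n. if n < M then 0 else l0 n) < d"
    by (auto simp: eventually_sequentially)
  let ?h = "\<lambda>n. if n < M then l0 n else 0" and ?r = "\<lambda>n. if n < M then 0 else l0 n"
  have hr: "?h \<in> lp_seq p" "?r \<in> lp_seq p" "lp_norm p ?h \<le> lp_norm p l0"
    by (rule lp_seq_mono[OF l0p(1) p0] lp_norm_mono[OF l0p(1) p0]; simp)+
  have "(\<lambda>n. ?h n + ?r n) = l0" by auto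
  then have "L l0 = L ?h + L ?r" using add[OF hr(1,2)] by simp
  then have "cmod (L l0) \<le> cmod (L ?h) + cmod (L ?r)" using norm_triangle_ineq by metis
  then have Lh: "S - 2 * d < cmod (L ?h)"
    using l0(2) M bnd[OF hr(2)] by linarith
  \<comment> \<open>Unimodular factors make both values of \<open>L\<close> nonnegative reals, so
    that they add up without cancellation.\<close>
  have rot: "\<exists>c. cmod c = 1 \<and> c * z = of_real (cmod z)" for z
    by (cases "z = 0") (auto intro: exI[of _ "of_real (cmod z) / z"] exI[of _ 1] simp: norm_divide)
  have small: "cmod (L m) \<le> e" if m: "m \<in> B" and m0: "\<And>n. n < M \<Longrightarrow> m n = 0" for m
  proof -
    obtain c1 where c1: "cmod c1 = 1" "c1 * L ?h = of_real (cmod (L ?h))" using rot by blast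
    obtain c2 where c2: "cmod c2 = 1" "c2 * L m = of_real (cmod (L m))" using rot by blast
    let ?l = "\<lambda>n. c1 * ?h n" and ?m = "\<lambda>n. c2 * m n"
    have mp: "m \<in> lp_seq p" "lp_norm p m \<le> 1" using m by (auto simp: B_def)
    have l': "?l \<in> lp_seq p" "lp_norm p ?l \<le> 1" using hr l0p(2) c1 p0 lp_seq_scale[OF hr(1)] by (auto simp: lp_norm_scale)
    have m': "?m \<in> lp_seq p" "lp_norm p ?m \<le> 1" using mp c2 p0 lp_seq_scale[OF mp(1)] by (auto simp: lp_norm_scale)
    have m'': "(\<lambda>n. of_real t * ?m n) \<in> lp_seq p" using m'(1) by (rule lp_seq_scale)
    have "L (\<lambda>n. ?l n + of_real t * ?m n) = L ?l + of_real t * L ?m"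
      using add[OF l'(1) m''] scale[OF m'(1), of "of_real t"] by simp
    also have "\<dots> = of_real (cmod (L ?h) + t * cmod (L m))"
      using scale[OF hr(1), of c1] scale[OF mp(1), of c2] c1 c2 by simp
    finally have "cmod (L (\<lambda>n. ?l n + of_real t * ?m n)) = cmod (L ?h) + t * cmod (L m)"
      using t0 by (simp del: of_real_add of_real_mult)
    moreover have "cmod (L (\<lambda>n. ?l n + of_real t * ?m n)) \<le> S * (1 + t powr p)"
    proof -
      have "lp_norm p (\<lambda>n. ?l n + of_real t * ?m n) \<le> 1 + t powr p"
        using l' m' p t0 m0 by (intro lp_norm_disjoint_le) auto
      then show ?thesis
        using LSn[OF lp_seq_add[OF l'(1) m'' p0]] S0 mult_left_mono order_trans by blast
    qed
    ultimately have "t * cmod (L m) \<le> S * t powr p + 2 * d"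
      using Lh by (simp add: algebra_simps)
    also have "\<dots> \<le> t * e" using St by (simp add: d_def mult_ac)
    finally show ?thesis using t0 by simp
  qed
  show ?thesis
  proof (rule that)
    fix l assume l: "l \<in> lp_seq p" and l0: "\<And>n. n < M \<Longrightarrow> l n = 0"
    show "cmod (L l) \<le> e * lp_norm p l"
      using l by (rule homog) (use l0 in \<open>auto intro: small\<close>)
  qed
qed

section \<open>Hitting a sequence of targets along one orbit\<close>

text \<open>At time \<open>n j\<close> the terms before \<open>j\<close> have been killed, term
  \<open>j\<close> yields \<open>c j * y j\<close>, and the later terms were chosen so small that
  amplification by \<open>C ^ n j\<close> does no harm. Errors are relative to
  \<open>cmod (c j)\<close>, which suits both choices of \<open>S\<close> made later.\<close>

lemma series_orbit_approximation:
  fixes X :: "'x set" and N :: "'x \<Rightarrow> real" and F :: "'x \<Rightarrow> 'x"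
    and y :: "nat \<Rightarrow> 'x \<Rightarrow> complex" and Z :: "('x \<Rightarrow> complex) set" and S :: "complex set"
  assumes FX: "\<And>f. f \<in> X \<Longrightarrow> F f \<in> X" and N0: "\<And>f. f \<in> X \<Longrightarrow> 0 \<le> N f"
    and C: "1 \<le> C" and FN: "\<And>f. f \<in> X \<Longrightarrow> N (F f) \<le> C * N f"
    and kill: "\<And>v. v \<in> Z \<Longrightarrow> \<exists>m. \<forall>n\<ge>m. \<forall>f\<in>X. v ((F ^^ n) f) = 0"
    and S0: "0 \<notin> S"
    and sel: "\<And>j m e. 0 < e \<Longrightarrow> \<exists>n\<ge>m. \<exists>v\<in>Z. \<exists>c\<in>S.
        (\<forall>f\<in>X. v ((F ^^ n) f) = c * y j f) \<and> (\<forall>f\<in>X. cmod (v f) \<le> e * N f)"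
  obtains v n c where "\<And>j. v j \<in> Z" "\<And>j f. f \<in> X \<Longrightarrow> cmod (v j f) \<le> (1 / 2) ^ j * N f"
    "\<And>j. c j \<in> S"
    "\<And>j f. f \<in> X \<Longrightarrow>
       cmod ((\<Sum>i. v i ((F ^^ n j) f)) - c j * y j f) \<le> cmod (c j) * (1 / 2) ^ j * N f"
proof -
  have FnX: "(F ^^ n) f \<in> X" if "f \<in> X" for n f
    using that by (induction n) (auto intro: FX)
  have FnN: "N ((F ^^ n) f) \<le> C ^ n * N f" if "f \<in> X" for n f
  proof (induction n)
    case (Suc n)
    have "N ((F ^^ Suc n) f) \<le> C * N ((F ^^ n) f)" using FN[OF FnX[OF that]] by simp
    also have "\<dots> \<le> C * (C ^ n * N f)" using Suc C by (intro mult_left_mono) auto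
    finally show ?case by (simp add: mult_ac)
  qed simp
  \<comment> \<open>A stage records the time \<open>n\<close>, the term \<open>v\<close>, its scalar
    \<open>c\<close>, a time \<open>M\<close> from which this and all earlier terms vanish, and a
    budget \<open>E\<close> limiting all later terms; \<open>Q\<close> hands \<open>M\<close> and
    \<open>E\<close> on to the next stage.\<close>
  define P :: "nat \<Rightarrow> (nat \<times> ('x \<Rightarrow> complex) \<times> complex \<times> nat \<times> real) \<Rightarrow> bool" where
    "P j = (\<lambda>(n, v, c, M, E). v \<in> Z \<and> c \<in> S \<and> (\<forall>f\<in>X. v ((F ^^ n) f) = c * y j f)
       \<and> (\<forall>k\<ge>M. \<forall>f\<in>X. v ((F ^^ k) f) = 0) \<and> 0 < E \<and> E \<le> 1 \<and> E * C ^ n \<le> cmod c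
       \<and> (\<forall>f\<in>X. cmod (v f) \<le> (1 / 2) ^ j * N f))" for j
  define Q :: "nat \<Rightarrow> (nat \<times> ('x \<Rightarrow> complex) \<times> complex \<times> nat \<times> real)
      \<Rightarrow> (nat \<times> ('x \<Rightarrow> complex) \<times> complex \<times> nat \<times> real) \<Rightarrow> bool" where
    "Q j = (\<lambda>(n, v, c, M, E) (n', v', c', M', E'). M \<le> n' \<and> M \<le> M' \<and> E' \<le> E
       \<and> (\<forall>f\<in>X. cmod (v' f) \<le> E * (1 / 2) ^ Suc j * N f))" for j
  have step: "\<exists>n v c M' E'. P j (n, v, c, M', E') \<and> M \<le> n \<and> M \<le> M' \<and> E' \<le> E
       \<and> (\<forall>f\<in>X. cmod (v f) \<le> E * (1 / 2) ^ j * N f)" if E: "0 < E" "E \<le> 1" for j M E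
  proof -
    have "0 < E * (1 / 2) ^ j" using E by simp
    from sel[OF this, of M j] obtain n v c where h: "M \<le> n" "v \<in> Z" "c \<in> S"
      "\<forall>f\<in>X. v ((F ^^ n) f) = c * y j f" "\<forall>f\<in>X. cmod (v f) \<le> E * (1 / 2) ^ j * N f"
      by blast
    obtain m where m: "\<forall>n\<ge>m. \<forall>f\<in>X. v ((F ^^ n) f) = 0" using kill[OF h(2)] by blast
    \<comment> \<open>The budget drops to at most \<open>cmod c / C ^ n\<close>, so that later terms
      pulled through \<open>F ^^ n\<close> remain small compared with \<open>c\<close>.\<close>
    let ?E = "min E (cmod c / C ^ n)"
    have c0: "c \<noteq> 0" using h(3) S0 by auto
    have Cn: "0 < C ^ n" using C by simp
    have v1: "cmod (v f) \<le> (1 / 2) ^ j * N f" if "f \<in> X" for f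
    proof -
      have "E * ((1 / 2) ^ j * N f) \<le> 1 * ((1 / 2) ^ j * N f)"
        using E N0[OF that] by (intro mult_right_mono) auto
      moreover have "cmod (v f) \<le> E * ((1 / 2) ^ j * N f)"
        using h(5) that by (simp add: mult.assoc)
      ultimately show ?thesis by linarith
    qed
    have "?E * C ^ n \<le> cmod c / C ^ n * C ^ n" using Cn by (intro mult_right_mono) auto
    also have "\<dots> = cmod c" using C by simp
    finally have "?E * C ^ n \<le> cmod c" .
    then have "P j (n, v, c, max M m, ?E)"
      unfolding P_def using h m v1 c0 Cn E by auto
    then show ?thesis using h by (intro exI[of _ n] exI[of _ v] exI[of _ c] exI[of _ "max M m"] exI[of _ ?E]) auto
  qed
  have "\<exists>s. \<forall>j. P j (s j) \<and> Q j (s j) (s (Suc j))"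
  proof (rule dependent_nat_choice)
    from step[of 1 0 0] obtain n v c M E where "P 0 (n, v, c, M, E)" by auto
    then show "\<exists>x. P 0 x" by blast
    fix x j assume x: "P j x"
    obtain n v c M E where xe: "x = (n, v, c, M, E)" by (cases x)
    then have "0 < E" "E \<le> 1" using x by (auto simp: P_def)
    from step[OF this, of "Suc j" M] show "\<exists>y. P (Suc j) y \<and> Q j x y"
      unfolding xe Q_def prod.case by blast
  qed
  then obtain s where s: "\<And>j. P j (s j)" "\<And>j. Q j (s j) (s (Suc j))" by blast
  define n where "n j = fst (s j)" for j
  define v where "v j = fst (snd (s j))" for j
  define c where "c j = fst (snd (snd (s j)))" for j
  define M where "M j = fst (snd (snd (snd (s j))))" for j
  define E where "E j = snd (snd (snd (snd (s j))))" for j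
  have se: "s j = (n j, v j, c j, M j, E j)" for j
    by (simp add: n_def v_def c_def M_def E_def)
  have Pj: "v j \<in> Z" "c j \<in> S" "\<And>f. f \<in> X \<Longrightarrow> v j ((F ^^ n j) f) = c j * y j f"
    "\<And>k f. M j \<le> k \<Longrightarrow> f \<in> X \<Longrightarrow> v j ((F ^^ k) f) = 0" "0 < E j" "E j \<le> 1"
    "E j * C ^ n j \<le> cmod (c j)" "\<And>f. f \<in> X \<Longrightarrow> cmod (v j f) \<le> (1 / 2) ^ j * N f" for j
    using s(1)[of j] unfolding se P_def by auto
  have Qj: "M j \<le> n (Suc j)" "M j \<le> M (Suc j)" "E (Suc j) \<le> E j"
    "\<And>f. f \<in> X \<Longrightarrow> cmod (v (Suc j) f) \<le> E j * (1 / 2) ^ Suc j * N f" for j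
    using s(2)[of j] unfolding se Q_def by auto
  have Mmono: "M i \<le> M j" if "i \<le> j" for i j
    using that Qj(2) by (rule lift_Suc_mono_le[rotated])
  have Emono: "E j \<le> E i" if "i \<le> j" for i j
    using that Qj(3) by (rule lift_Suc_antimono_le[rotated])
  show ?thesis
  proof (rule that)
    fix j f assume f: "f \<in> X"
    let ?g = "(F ^^ n j) f"
    have g: "?g \<in> X" using f by (rule FnX)
    have summ: "summable (\<lambda>i. v i ?g)"
      by (rule summable_comparison_test'[of "\<lambda>i. (1 / 2) ^ i * N ?g" 0])
        (use Pj(8)[OF g] in \<open>auto intro!: summable_mult2 summable_geometric\<close>)
    have before: "v i ?g = 0" if ij: "i < j" for i
    proof -
      obtain k where k: "j = Suc k" "i \<le> k" using ij by (cases j) auto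
      then have "M i \<le> n j" using Mmono[OF k(2)] Qj(1)[of k] by simp
      then show ?thesis using Pj(4) f by blast
    qed
    \<comment> \<open>Term \<open>i + j + 1\<close> obeys the budget of stage \<open>i + j\<close>,
      which is at most that of stage \<open>j\<close>; this absorbs the factor
      \<open>C ^ n j\<close>.\<close>
    have after: "cmod (v (i + Suc j) ?g) \<le> (cmod (c j) * N f * (1 / 2) ^ Suc j) * (1 / 2) ^ i" for i
    proof -
      have "cmod (v (Suc (i + j)) ?g) \<le> E (i + j) * (1 / 2) ^ Suc (i + j) * N ?g"
        using Qj(4)[OF g] .
      also have "\<dots> \<le> E j * (1 / 2) ^ Suc (i + j) * (C ^ n j * N f)"
        using Emono[of j "i + j"] FnN[OF f] N0[OF g] Pj(5)[of j]
        by (intro mult_mono) auto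
      also have "\<dots> = (E j * C ^ n j) * ((1 / 2) ^ Suc (i + j) * N f)" by (simp add: mult_ac)
      also have "\<dots> \<le> cmod (c j) * ((1 / 2) ^ Suc (i + j) * N f)"
        using Pj(7) N0[OF f] by (intro mult_right_mono) auto
      finally show ?thesis by (simp add: power_add mult_ac)
    qed
    have geo: "(\<lambda>i. (cmod (c j) * N f * (1 / 2) ^ Suc j) * (1 / 2) ^ i) sums
        ((cmod (c j) * N f * (1 / 2) ^ Suc j) * (1 / (1 - 1 / 2)))"
      by (intro sums_mult geometric_sums) simp
    have "(\<Sum>i. v i ?g) = (\<Sum>i. v (i + Suc j) ?g) + (\<Sum>i<Suc j. v i ?g)"
      using summ by (rule suminf_split_initial_segment)
    also have "(\<Sum>i<Suc j. v i ?g) = c j * y j f"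
      using before Pj(3)[OF f] by simp
    finally have "cmod ((\<Sum>i. v i ?g) - c j * y j f) = cmod (\<Sum>i. v (i + Suc j) ?g)" by simp
    also have "\<dots> \<le> (\<Sum>i. (cmod (c j) * N f * (1 / 2) ^ Suc j) * (1 / 2) ^ i)"
      using after sums_summable[OF geo] by (intro norm_suminf_le)
    also have "\<dots> = cmod (c j) * (1 / 2) ^ j * N f"
      using sums_unique[OF geo] by simp
    finally show "cmod ((\<Sum>i. v i ?g) - c j * y j f) \<le> cmod (c j) * (1 / 2) ^ j * N f" .
  qed (use Pj in auto)
qed

text \<open>Bridges the extended-real liminf conditions of the theorem and the selection of late
  indices in the constructions.\<close>

lemma liminf_ereal_eq_0_iff:
  fixes g :: "nat \<Rightarrow> real"
  assumes "\<And>n. 0 \<le> g n"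
  shows "liminf (\<lambda>n. ereal (g n)) = 0 \<longleftrightarrow> (\<forall>e>0. \<forall>m. \<exists>n\<ge>m. g n < e)" (is "?l \<longleftrightarrow> ?r")
proof
  assume l: ?l
  show ?r
  proof (rule ccontr)
    assume "\<not> ?r"
    then obtain e m where e: "0 < e" "\<And>n. m \<le> n \<Longrightarrow> e \<le> g n" by (meson not_less)
    then have "ereal e \<le> liminf (\<lambda>n. ereal (g n))"
      by (intro Liminf_bounded) (auto simp: eventually_sequentially)
    then show False using l e(1) by simp
  qed
next
  assume r: ?r
  have "0 \<le> liminf (\<lambda>n. ereal (g n))"
    using assms by (intro Liminf_bounded) (auto intro: always_eventually)
  moreover have "liminf (\<lambda>n. ereal (g n)) \<le> 0"
  proof (rule ccontr)
    assume "\<not> ?thesis"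
    then obtain x where x: "0 < ereal x" "ereal x < liminf (\<lambda>n. ereal (g n))"
      by (metis ereal_dense2 not_le)
    from less_LiminfD[OF x(2)] obtain m where "\<And>n. m \<le> n \<Longrightarrow> x < g n"
      by (auto simp: eventually_sequentially)
    then show False using r x(1) by (metis ereal_less(2) not_less_iff_gr_or_eq)
  qed
  ultimately show ?l by simp
qed

section \<open>Taylor coefficients of basis expansions\<close>

text \<open>Collects powers of \<open>z\<close> in the expansion: \<open>fbasis a b n\<close>
  contributes \<open>a n\<close> to \<open>z ^ n\<close> and \<open>b n\<close> to
  \<open>z ^ (n + 1)\<close>. Being purely formal, it also applies to sequences not yet known to lie
  in l^p.\<close>

definition ab_taylor :: "(nat \<Rightarrow> complex) \<Rightarrow> (nat \<Rightarrow> complex) \<Rightarrow> (nat \<Rightarrow> complex) \<Rightarrow> nat \<Rightarrow> complex" where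
  "ab_taylor a b l n = a n * l n + (case n of 0 \<Rightarrow> 0 | Suc k \<Rightarrow> b k * l k)"

text \<open>The system is lower bidiagonal with nonzero diagonal \<open>a\<close>, so forward
  substitution solves it.\<close>

lemma ab_taylor_inj:
  assumes "\<And>n. a n \<noteq> 0" "ab_taylor a b l = ab_taylor a b m"
  shows "l = m"
proof
  fix n
  show "l n = m n"
  proof (induction n)
    case 0
    then show ?case using fun_cong[OF assms(2), of 0] assms(1)[of 0] by (simp add: ab_taylor_def)
  next
    case (Suc n)
    then show ?case
      using fun_cong[OF assms(2), of "Suc n"] assms(1)[of "Suc n"] by (simp add: ab_taylor_def)
  qed
qed

locale lpab_space =
  fixes p :: real and a b :: "nat \<Rightarrow> complex"
  assumes p: "1 < p" and a_nz: "\<And>n. a n \<noteq> 0" and growth: "ab_rho a b < \<infinity>"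
begin

lemma p_pos: "0 < p" using p by simp

lemma rho_nonneg: "0 \<le> ab_rho a b"
proof -
  have "0 \<le> liminf (\<lambda>n. ereal (root n (cmod (a n) + cmod (b n))))"
    by (rule Liminf_bounded) (auto intro!: always_eventually simp: real_root_ge_zero)
  also have "\<dots> \<le> ab_rho a b" unfolding ab_rho_def by (rule Liminf_le_Limsup) simp
  finally show ?thesis .
qed

text \<open>\<open>ab_rho\<close> is the reciprocal of the radius of convergence of the power series
  with coefficients \<open>cmod (a n) + cmod (b n)\<close>.\<close>

lemma disc_summable:
  assumes "z \<in> ab_disc a b"
  shows "summable (\<lambda>n. (cmod (a n) + cmod (b n)) * cmod z ^ n)"
proof -
  have "ereal (norm (cmod z)) < conv_radius (\<lambda>n. cmod (a n) + cmod (b n))"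
    using assms rho_nonneg growth unfolding conv_radius_def ab_disc_def
    by (cases "ab_rho a b") (auto simp: ab_rho_def[symmetric] one_ereal_def field_simps)
  from abs_summable_in_conv_radius[OF this] show ?thesis
    by (simp add: abs_mult)
qed

lemma disc_contains_ball:
  obtains r where "0 < r" "\<And>z. cmod z < r \<Longrightarrow> z \<in> ab_disc a b"
proof -
  obtain s where s: "ab_rho a b = ereal s" "0 \<le> s"
    using rho_nonneg growth by (cases "ab_rho a b") auto
  \<comment> \<open>The radius \<open>1 / (s + 1)\<close> is below \<open>1 / s\<close> and remains
    meaningful for \<open>s = 0\<close>.\<close>
  have "z \<in> ab_disc a b" if "cmod z < 1 / (s + 1)" for z
  proof -
    have "cmod z * (s + 1) < 1" using that s by (simp add: field_simps)
    then show ?thesis using s by (simp add: ab_disc_def one_ereal_def algebra_simps) (smt (verit) norm_ge_zero)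
  qed
  then show ?thesis using s that[of "1 / (s + 1)"] by simp
qed

text \<open>\<open>taylor_coef\<close> depends only on the germ at 0. Convergence at the point
  \<open>r / 2\<close> gives a positive radius of convergence, so the series is the expansion of
  \<open>f\<close> there.\<close>

lemma taylor_coef_unique:
  assumes "\<And>z. z \<in> ab_disc a b \<Longrightarrow> (\<lambda>n. m n * z ^ n) sums f z"
  shows "taylor_coef f n = m n"
proof -
  obtain r where r: "0 < r" "\<And>z. cmod z < r \<Longrightarrow> z \<in> ab_disc a b" by (rule disc_contains_ball) blast
  have "summable (\<lambda>n. m n * of_real (r / 2) ^ n)"
    using assms[OF r(2), of "of_real (r / 2)"] r(1) by (simp add: sums_iff)
  from conv_radius_geI[OF this] have "ereal (r / 2) \<le> conv_radius m"
    using r(1) by (simp del: of_real_divide)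
  moreover have "0 < ereal (r / 2)" using r(1) by simp
  ultimately have "0 < conv_radius m" by (rule order.strict_trans2[rotated])
  moreover have "eventually (\<lambda>z. eval_fps (Abs_fps m) z = f z) (nhds 0)"
    unfolding eventually_nhds_metric eval_fps_def using r assms
    by (intro exI[of _ r]) (auto simp: sums_iff dist_norm)
  ultimately have "f has_fps_expansion Abs_fps m"
    by (simp add: has_fps_expansion_def fps_conv_radius_def)
  from fps_nth_fps_expansion[OF this, of n] show ?thesis
    by (simp add: taylor_coef_def)
qed

text \<open>Sequences in l^p are bounded by their norm, so \<open>disc_summable\<close> dominates
  both halves of the expansion.\<close>

lemma lp_summable:
  assumes "l \<in> lp_seq p" "z \<in> ab_disc a b"
  shows "summable (\<lambda>n. l n * a n * z ^ n)" "summable (\<lambda>n. l n * b n * z ^ Suc n)"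
proof -
  let ?c = "\<lambda>n. (cmod (a n) + cmod (b n)) * cmod z ^ n"
  have s: "summable (\<lambda>n. lp_norm p l * ?c n)" "summable (\<lambda>n. (lp_norm p l * cmod z) * ?c n)"
    using disc_summable[OF assms(2)] by (intro summable_mult; simp)+
  have l: "cmod (l n) \<le> lp_norm p l" for n by (rule norm_le_lp_norm[OF assms(1) p_pos])
  show "summable (\<lambda>n. l n * a n * z ^ n)"
  proof (rule summable_comparison_test'[OF s(1)])
    fix n
    have "cmod (l n) * (cmod (a n) * cmod z ^ n) \<le> lp_norm p l * ?c n"
      by (intro mult_mono l mult_right_mono) (auto simp: lp_norm_nonneg)
    then show "norm (l n * a n * z ^ n) \<le> lp_norm p l * ?c n"
      by (simp add: norm_mult norm_power mult.assoc)
  qed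
  show "summable (\<lambda>n. l n * b n * z ^ Suc n)"
  proof (rule summable_comparison_test'[OF s(2)])
    fix n
    have "cmod (l n) * cmod z * (cmod (b n) * cmod z ^ n) \<le> lp_norm p l * cmod z * ?c n"
      by (intro mult_mono l mult_right_mono) (auto simp: lp_norm_nonneg)
    then show "norm (l n * b n * z ^ Suc n) \<le> lp_norm p l * cmod z * ?c n"
      by (simp add: norm_mult norm_power mult_ac)
  qed
qed

text \<open>Both series recombine the same two convergent halves; passing to powers of
  \<open>z\<close> delays the \<open>b\<close> half by one index.\<close>

lemma lp_sums_taylor:
  assumes "l \<in> lp_seq p" "z \<in> ab_disc a b"
  obtains s where "(\<lambda>n. l n * fbasis a b n z) sums s" "(\<lambda>n. ab_taylor a b l n * z ^ n) sums s"
proof -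
  let ?A = "\<lambda>n. l n * a n * z ^ n" and ?B = "\<lambda>n. l n * b n * z ^ Suc n"
  let ?s = "suminf ?A + suminf ?B"
  have A: "?A sums suminf ?A" and B: "?B sums suminf ?B"
    using lp_summable[OF assms] by (blast intro: summable_sums)+
  have "(\<lambda>n. case n of 0 \<Rightarrow> 0 | Suc k \<Rightarrow> ?B k) sums suminf ?B"
    using B sums_Suc_iff[of "\<lambda>n. case n of 0 \<Rightarrow> 0 | Suc k \<Rightarrow> ?B k"] by simp
  from sums_add[OF A this] have "(\<lambda>n. ab_taylor a b l n * z ^ n) sums ?s"
    by (rule back_subst[where P = "\<lambda>f. f sums ?s"])
       (auto simp: ab_taylor_def fun_eq_iff algebra_simps split: nat.split)
  moreover have "(\<lambda>n. l n * fbasis a b n z) sums ?s"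
    using sums_add[OF A B] by (simp add: fbasis_def algebra_simps)
  ultimately show ?thesis using that by blast
qed

lemma represents_sums_taylor:
  assumes "l \<in> lp_seq p" "ab_represents a b l f" "z \<in> ab_disc a b"
  shows "(\<lambda>n. ab_taylor a b l n * z ^ n) sums f z"
  using lp_sums_taylor[OF assms(1,3)] assms(2,3) unfolding ab_represents_def
  by (metis sums_unique2)

lemma represents_taylor_coef:
  assumes "l \<in> lp_seq p" "ab_represents a b l f"
  shows "taylor_coef f n = ab_taylor a b l n"
  using represents_sums_taylor[OF assms] by (rule taylor_coef_unique)

text \<open>Two expansions of \<open>f\<close> share its Taylor coefficients and therefore agree by
  \<open>ab_taylor_inj\<close>; this legitimises the definite description.\<close>

lemma lpab_coef_eq:
  assumes "l \<in> lp_seq p" "ab_represents a b l f"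
  shows "lpab_coef p a b f = l"
  unfolding lpab_coef_def
proof (rule the_equality)
  fix m assume m: "m \<in> lp_seq p \<and> ab_represents a b m f"
  have "ab_taylor a b m = ab_taylor a b l"
    using represents_taylor_coef[OF assms] represents_taylor_coef[of m f] m by auto
  with a_nz show "m = l" by (rule ab_taylor_inj)
qed (use assms in blast)

section \<open>The function space as a copy of l^p\<close>

abbreviation "X \<equiv> lpab p a b"
abbreviation "nrm \<equiv> lpab_norm p a b"
abbreviation "coef \<equiv> lpab_coef p a b"

lemma coef_props:
  assumes "f \<in> X"
  shows "coef f \<in> lp_seq p" "ab_represents a b (coef f) f"
proof -
  obtain l where l: "l \<in> lp_seq p" "ab_represents a b l f"
    using assms by (auto simp: lpab_def)
  then show "coef f \<in> lp_seq p" "ab_represents a b (coef f) f"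
    by (simp_all add: lpab_coef_eq[OF l])
qed

lemma norm_eq_lp_norm: "nrm f = lp_norm p (coef f)"
  by (simp add: lpab_norm_def lp_norm_def)

lemma norm_nonneg: "0 \<le> nrm f"
  by (simp add: norm_eq_lp_norm lp_norm_nonneg)

lemma taylor_coef_eq: "f \<in> X \<Longrightarrow> taylor_coef f n = ab_taylor a b (coef f) n"
  using coef_props represents_taylor_coef by blast

text \<open>Inverse of \<open>coef\<close>: transports l^p sequences to functions, with the value 0
  off the disc that \<open>ab_represents\<close> demands.\<close>

definition synth :: "(nat \<Rightarrow> complex) \<Rightarrow> complex \<Rightarrow> complex" where
  "synth l z = (if z \<in> ab_disc a b then (\<Sum>n. l n * fbasis a b n z) else 0)"

lemma synth:
  assumes "l \<in> lp_seq p"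
  shows "ab_represents a b l (synth l)" "synth l \<in> X" "coef (synth l) = l"
proof -
  have "(\<lambda>n. l n * fbasis a b n z) sums synth l z" if "z \<in> ab_disc a b" for z
    using lp_sums_taylor[OF assms that] that by (metis synth_def sums_unique)
  then show r: "ab_represents a b l (synth l)"
    by (simp add: ab_represents_def synth_def)
  then show "synth l \<in> X" using assms by (auto simp: lpab_def)
  show "coef (synth l) = l" using lpab_coef_eq[OF assms r] .
qed

lemma synth_coef:
  assumes "f \<in> X" shows "synth (coef f) = f"
proof
  fix z show "synth (coef f) z = f z"
    using synth(1)[OF coef_props(1)[OF assms]] coef_props(2)[OF assms]
    by (cases "z \<in> ab_disc a b") (auto simp: ab_represents_def intro: sums_unique2)
qed

lemma add_props:
  assumes "f \<in> X" "g \<in> X"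
  shows "(\<lambda>z. f z + g z) \<in> X" "coef (\<lambda>z. f z + g z) = (\<lambda>n. coef f n + coef g n)"
proof -
  have r: "ab_represents a b (\<lambda>n. coef f n + coef g n) (\<lambda>z. f z + g z)"
    using coef_props(2)[OF assms(1)] coef_props(2)[OF assms(2)]
    unfolding ab_represents_def by (auto simp: distrib_right intro!: sums_add)
  have m: "(\<lambda>n. coef f n + coef g n) \<in> lp_seq p"
    using assms coef_props p_pos by (intro lp_seq_add) auto
  show "(\<lambda>z. f z + g z) \<in> X" using r m by (auto simp: lpab_def)
  show "coef (\<lambda>z. f z + g z) = (\<lambda>n. coef f n + coef g n)" using lpab_coef_eq[OF m r] .
qed

lemma scale_props:
  assumes "f \<in> X"
  shows "(\<lambda>z. c * f z) \<in> X" "coef (\<lambda>z. c * f z) = (\<lambda>n. c * coef f n)"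
proof -
  have r: "ab_represents a b (\<lambda>n. c * coef f n) (\<lambda>z. c * f z)"
    using coef_props(2)[OF assms(1)]
    unfolding ab_represents_def by (auto simp: mult.assoc intro!: sums_mult)
  have m: "(\<lambda>n. c * coef f n) \<in> lp_seq p"
    using assms coef_props by (intro lp_seq_scale) auto
  show "(\<lambda>z. c * f z) \<in> X" using r m by (auto simp: lpab_def)
  show "coef (\<lambda>z. c * f z) = (\<lambda>n. c * coef f n)" using lpab_coef_eq[OF m r] .
qed

lemma norm_scale: "f \<in> X \<Longrightarrow> nrm (\<lambda>z. c * f z) = cmod c * nrm f"
  using coef_props p_pos by (simp add: norm_eq_lp_norm scale_props lp_norm_scale)

lemma taylor_coef_add:
  "f \<in> X \<Longrightarrow> g \<in> X \<Longrightarrow> taylor_coef (\<lambda>z. f z + g z) n = taylor_coef f n + taylor_coef g n"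
  by (simp add: taylor_coef_eq add_props ab_taylor_def algebra_simps split: nat.split)

lemma taylor_coef_scale: "f \<in> X \<Longrightarrow> taylor_coef (\<lambda>z. c * f z) n = c * taylor_coef f n"
  by (simp add: taylor_coef_eq scale_props ab_taylor_def algebra_simps split: nat.split)

lemma lpab_eqI:
  assumes "f \<in> X" "g \<in> X" "\<And>n. taylor_coef f n = taylor_coef g n"
  shows "f = g"
proof -
  have "ab_taylor a b (coef f) = ab_taylor a b (coef g)"
    using assms by (auto simp: taylor_coef_eq)
  with a_nz have "coef f = coef g" by (rule ab_taylor_inj)
  then show ?thesis using synth_coef[OF assms(1)] synth_coef[OF assms(2)] by metis
qed

text \<open>Only the coordinates \<open>n\<close> and \<open>n - 1\<close> enter. At
  \<open>n = 0\<close> truncated subtraction makes \<open>b 0\<close> appear, which merely weakens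
  the bound.\<close>

lemma taylor_coef_bound:
  assumes "f \<in> X"
  shows "cmod (taylor_coef f n) \<le> (cmod (a n) + cmod (b (n - 1))) * nrm f"
proof -
  have c: "cmod (coef f k) \<le> nrm f" for k
    unfolding norm_eq_lp_norm by (rule norm_le_lp_norm[OF coef_props(1)[OF assms] p_pos])
  have "cmod (taylor_coef f n) \<le> cmod (a n) * cmod (coef f n) + cmod (b (n - 1)) * cmod (coef f (n - 1))"
    unfolding taylor_coef_eq[OF assms] ab_taylor_def
    by (cases n) (auto simp: norm_mult intro: order_trans[OF norm_triangle_ineq])
  also have "\<dots> \<le> cmod (a n) * nrm f + cmod (b (n - 1)) * nrm f"
    using c by (intro add_mono mult_left_mono) auto
  finally show ?thesis by (simp add: algebra_simps)
qed

lemma zero_props: "(\<lambda>z. 0) \<in> X" "nrm (\<lambda>z. 0) = 0"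
proof -
  have l: "(\<lambda>n. 0) \<in> lp_seq p" using p_pos by (simp add: lp_seq_def)
  have s: "synth (\<lambda>n. 0) = (\<lambda>z. 0)" by (auto simp: synth_def)
  show "(\<lambda>z. 0) \<in> X" using synth(2)[OF l] s by simp
  show "nrm (\<lambda>z. 0) = 0" using synth(3)[OF l] s by (simp add: norm_eq_lp_norm lp_norm_def)
qed

section \<open>The dual space and its distance\<close>

abbreviation "dual \<equiv> lpab_dual p a b"

lemma dual_bound:
  assumes "\<phi> \<in> dual"
  obtains C where "0 \<le> C" "\<And>f. f \<in> X \<Longrightarrow> cmod (\<phi> f) \<le> C * nrm f"
proof -
  obtain C where C: "\<And>f. f \<in> X \<Longrightarrow> cmod (\<phi> f) \<le> C * nrm f"
    using assms unfolding lpab_dual_def by blast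
  have "cmod (\<phi> f) \<le> \<bar>C\<bar> * nrm f" if "f \<in> X" for f
    using C[OF that] mult_right_mono[OF abs_ge_self[of C] norm_nonneg[of f]] by linarith
  then show ?thesis using that[of "\<bar>C\<bar>"] by simp
qed

lemma dual_dist_le:
  assumes "0 \<le> e" "\<And>f. f \<in> X \<Longrightarrow> cmod (\<phi> f - \<psi> f) \<le> e * nrm f"
  shows "dual_dist p a b \<phi> \<psi> \<le> e"
  unfolding dual_dist_def dual_norm_def
proof (rule cSUP_least)
  show "{f \<in> X. nrm f \<le> 1} \<noteq> {}" using zero_props by force
  fix f assume "f \<in> {f \<in> X. nrm f \<le> 1}"
  then show "cmod (\<phi> f - \<psi> f) \<le> e"
    using assms(2)[of f] mult_left_mono[of "nrm f" 1 e] assms(1) by auto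
qed

text \<open>A real supremum bounds its elements only when the set is bounded, which
  \<open>bound\<close> guarantees; \<open>scale\<close> then extends the estimate from the unit
  ball.\<close>

lemma dual_dist_lessD:
  assumes d: "dual_dist p a b \<phi> \<psi> < e"
    and scale: "\<And>c f. f \<in> X \<Longrightarrow> \<phi> (\<lambda>z. c * f z) - \<psi> (\<lambda>z. c * f z) = c * (\<phi> f - \<psi> f)"
    and bound: "\<And>f. f \<in> X \<Longrightarrow> cmod (\<phi> f - \<psi> f) \<le> C * nrm f" and C: "0 \<le> C"
    and f: "f \<in> X"
  shows "cmod (\<phi> f - \<psi> f) \<le> e * nrm f"
proof (cases "nrm f = 0")
  case True
  then show ?thesis using bound[OF f] by simp
next
  case False
  then have pos: "0 < nrm f" using norm_nonneg[of f] by linarith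
  let ?c = "of_real (1 / nrm f) :: complex"
  let ?B = "{f \<in> X. nrm f \<le> 1}"
  have "bdd_above ((\<lambda>f. cmod (\<phi> f - \<psi> f)) ` ?B)"
  proof (rule bdd_aboveI2)
    fix g assume "g \<in> ?B"
    then show "cmod (\<phi> g - \<psi> g) \<le> C"
      using bound[of g] mult_left_mono[of "nrm g" 1 C] C by auto
  qed
  moreover have "(\<lambda>z. ?c * f z) \<in> ?B"
    using scale_props(1)[OF f, of ?c] norm_scale[OF f, of ?c] pos by (simp add: norm_divide)
  ultimately have "cmod (\<phi> (\<lambda>z. ?c * f z) - \<psi> (\<lambda>z. ?c * f z)) \<le> dual_dist p a b \<phi> \<psi>"
    unfolding dual_dist_def dual_norm_def by (intro cSUP_upper)
  then have "cmod (?c * (\<phi> f - \<psi> f)) \<le> e" unfolding scale[OF f] using d by linarith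
  then show ?thesis using pos by (simp add: norm_mult norm_divide field_simps)
qed

section \<open>A countable dense family of Taylor functionals\<close>

text \<open>Solves \<open>taylor_coef f M = a M * coef f M + b (M - 1) * coef f (M - 1)\<close> for
  the last coordinate and moves the remainder to coordinate \<open>M - 1\<close>; hence the
  induction generalises over \<open>c\<close>.\<close>

lemma coef_combination_eq_taylor:
  "\<exists>d. \<forall>f\<in>X. (\<Sum>n<M. c n * coef f n) = (\<Sum>n<M. d n * taylor_coef f n)"
proof (induction M arbitrary: c)
  case (Suc M)
  show ?case
  proof (cases M)
    case 0
    then show ?thesis using a_nz[of 0]
      by (intro exI[of _ "\<lambda>n. c 0 / a 0"]) (simp add: taylor_coef_eq ab_taylor_def)
  next
    case (Suc K)
    define c' where "c' = c(K := c K - c M * b K / a M)"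
    obtain d where d: "\<And>f. f \<in> X \<Longrightarrow> (\<Sum>n<M. c' n * coef f n) = (\<Sum>n<M. d n * taylor_coef f n)"
      using Suc.IH[of c'] by blast
    have "(\<Sum>n<Suc M. c n * coef f n) = (\<Sum>n<Suc M. (d(M := c M / a M)) n * taylor_coef f n)"
      if f: "f \<in> X" for f
    proof -
      have "(\<Sum>n<Suc M. c n * coef f n) = (\<Sum>n<M. c' n * coef f n) + c M * b K / a M * coef f K + c M * coef f M"
        by (simp add: Suc c'_def algebra_simps)
      also have "\<dots> = (\<Sum>n<M. d n * taylor_coef f n) + c M / a M * taylor_coef f M"
        unfolding d[OF f] using a_nz[of M] taylor_coef_eq[OF f, of M]
        by (simp add: Suc ab_taylor_def field_simps)
      finally show ?thesis by simp
    qed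
    then show ?thesis by blast
  qed
qed simp

text \<open>On the sequence side the tail of the functional is small because \<open>1 < p\<close>,
  and the head is a finite combination of coordinates, hence of Taylor coefficients.\<close>

lemma dual_taylor_approx:
  assumes \<psi>: "\<psi> \<in> dual" and e: "0 < e"
  obtains M d where "\<And>f. f \<in> X \<Longrightarrow> cmod (\<psi> f - (\<Sum>n<M. d n * taylor_coef f n)) \<le> e * nrm f"
proof -
  define L where "L l = \<psi> (synth l)" for l
  obtain C where C: "\<And>f. f \<in> X \<Longrightarrow> cmod (\<psi> f) \<le> C * nrm f" using dual_bound[OF \<psi>] by blast
  have synth_add: "synth (\<lambda>n. l n + m n) = (\<lambda>z. synth l z + synth m z)"
    if "l \<in> lp_seq p" "m \<in> lp_seq p" for l m
    using synth_coef[OF add_props(1)[OF synth(2)[OF that(1)] synth(2)[OF that(2)]]]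
      add_props(2)[OF synth(2)[OF that(1)] synth(2)[OF that(2)]] that by (simp add: synth(3))
  have synth_scale: "synth (\<lambda>n. c * l n) = (\<lambda>z. c * synth l z)" if "l \<in> lp_seq p" for c l
    using synth_coef[OF scale_props(1)[OF synth(2)[OF that]]]
      scale_props(2)[OF synth(2)[OF that]] that by (simp add: synth(3))
  have Ladd: "L (\<lambda>n. l n + m n) = L l + L m" if "l \<in> lp_seq p" "m \<in> lp_seq p" for l m
    using \<psi> synth(2) that unfolding L_def synth_add[OF that] lpab_dual_def by blast
  have Lscale: "L (\<lambda>n. c * l n) = c * L l" if "l \<in> lp_seq p" for c l
    using \<psi> synth(2) that unfolding L_def synth_scale[OF that] lpab_dual_def by blast
  have Lbound: "cmod (L l) \<le> C * lp_norm p l" if "l \<in> lp_seq p" for l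
    using C[OF synth(2)[OF that]] that by (simp add: L_def norm_eq_lp_norm synth(3))
  obtain M where M: "\<And>l. l \<in> lp_seq p \<Longrightarrow> (\<And>n. n < M \<Longrightarrow> l n = 0) \<Longrightarrow> cmod (L l) \<le> e * lp_norm p l"
    using lp_functional_tail_small[OF p e Ladd Lscale Lbound] by blast
  define u :: "nat \<Rightarrow> nat \<Rightarrow> complex" where "u k n = (if n = k then 1 else 0)" for k n
  have u: "u k \<in> lp_seq p" for k
  proof -
    have "summable (\<lambda>n. cmod (u k n) powr p)"
      by (rule summable_finite[of "{k}"]) (auto simp: u_def p_pos)
    then show ?thesis by (simp add: lp_seq_def)
  qed
  have trunc: "(\<lambda>n. if n < K then l n else 0) \<in> lp_seq p" if "l \<in> lp_seq p" for K l
    by (rule lp_seq_mono[OF that p_pos]) auto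
  have head: "L (\<lambda>n. if n < K then l n else 0) = (\<Sum>n<K. L (u n) * l n)" if l: "l \<in> lp_seq p" for K l
  proof (induction K)
    case 0
    show ?case using Lscale[OF l, of 0] by simp
  next
    case (Suc K)
    have "(\<lambda>n. if n < Suc K then l n else 0) = (\<lambda>n. (if n < K then l n else 0) + l K * u K n)"
      by (auto simp: u_def less_Suc_eq)
    then show ?case
      using Suc Ladd[OF trunc[OF l] lp_seq_scale[OF u]] Lscale[OF u] by (simp add: mult.commute)
  qed
  obtain d where d: "\<And>f. f \<in> X \<Longrightarrow> (\<Sum>n<M. L (u n) * coef f n) = (\<Sum>n<M. d n * taylor_coef f n)"
    using coef_combination_eq_taylor[of "\<lambda>n. L (u n)" M] by blast
  show ?thesis
  proof (rule that)
    fix f assume f: "f \<in> X"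
    note l = coef_props(1)[OF f]
    let ?r = "\<lambda>n. if n < M then 0 else coef f n"
    have r: "?r \<in> lp_seq p" by (rule lp_seq_mono[OF l p_pos]) auto
    have split: "(\<lambda>n. (if n < M then coef f n else 0) + ?r n) = coef f" by auto
    have "L (coef f) = L (\<lambda>n. if n < M then coef f n else 0) + L ?r"
      using Ladd[OF trunc[OF l] r, of M] unfolding split .
    then have "\<psi> f - (\<Sum>n<M. d n * taylor_coef f n) = L ?r"
      using head[OF l] d[OF f] synth_coef[OF f] by (simp add: L_def)
    moreover have "cmod (L ?r) \<le> e * lp_norm p ?r" using r by (rule M) simp
    moreover have "e * lp_norm p ?r \<le> e * nrm f"
      unfolding norm_eq_lp_norm using e by (intro mult_left_mono lp_norm_mono l p_pos) auto
    ultimately show "cmod (\<psi> f - (\<Sum>n<M. d n * taylor_coef f n)) \<le> e * nrm f" by simp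
  qed
qed

definition rat_complex :: "rat \<times> rat \<Rightarrow> complex" where
  "rat_complex q = Complex (of_rat (fst q)) (of_rat (snd q))"

text \<open>Indexing by lists over a countable type lets \<open>from_nat\<close> enumerate these
  functionals.\<close>

definition rat_functional :: "(rat \<times> rat) list \<Rightarrow> (complex \<Rightarrow> complex) \<Rightarrow> complex" where
  "rat_functional d f = (\<Sum>n<length d. rat_complex (d ! n) * taylor_coef f n)"

lemma rat_complex_dense:
  assumes "0 < e" shows "\<exists>q. cmod (z - rat_complex q) < e"
proof -
  obtain x where x: "Re z < of_rat x" "of_rat x < Re z + e / 2"
    using of_rat_dense[of "Re z" "Re z + e / 2"] assms by auto
  obtain y where y: "Im z < of_rat y" "of_rat y < Im z + e / 2"
    using of_rat_dense[of "Im z" "Im z + e / 2"] assms by auto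
  have "cmod (z - rat_complex (x, y)) \<le> \<bar>Re z - of_rat x\<bar> + \<bar>Im z - of_rat y\<bar>"
    using cmod_le[of "z - rat_complex (x, y)"] by (simp add: rat_complex_def)
  also have "\<dots> < e" using x y by simp
  finally show ?thesis by blast
qed

lemma dual_rat_approx:
  assumes \<psi>: "\<psi> \<in> dual" and e: "0 < e"
  obtains d where "\<And>f. f \<in> X \<Longrightarrow> cmod (\<psi> f - rat_functional d f) \<le> e * nrm f"
proof -
  obtain M c where c: "\<And>f. f \<in> X \<Longrightarrow> cmod (\<psi> f - (\<Sum>n<M. c n * taylor_coef f n)) \<le> e / 2 * nrm f"
    using dual_taylor_approx[OF \<psi> half_gt_zero[OF e]] by blast
  define K where "K n = cmod (a n) + cmod (b (n - 1))" for n
  \<comment> \<open>Changing each of the \<open>M\<close> coefficients by at most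
    \<open>\<delta>\<close> costs at most \<open>e / 2\<close>; the added 1 keeps the denominator
    positive.\<close>
  define \<delta> where "\<delta> = e / (2 * ((\<Sum>n<M. K n) + 1))"
  have K0: "0 \<le> (\<Sum>n<M. K n)" by (intro sum_nonneg) (simp add: K_def)
  then have \<delta>0: "0 < \<delta>" using e by (simp add: \<delta>_def)
  have "\<forall>n. \<exists>q. cmod (c n - rat_complex q) < \<delta>" using rat_complex_dense[OF \<delta>0] by blast
  from choice[OF this] obtain q where q: "\<And>n. cmod (c n - rat_complex (q n)) < \<delta>" by blast
  have \<delta>K: "\<delta> * (\<Sum>n<M. K n) \<le> e / 2"
    unfolding \<delta>_def using K0 e by (simp add: field_simps)
  show ?thesis
  proof (rule that)
    fix f assume f: "f \<in> X"
    have "cmod ((\<Sum>n<M. c n * taylor_coef f n) - rat_functional (map q [0..<M]) f)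
        = cmod (\<Sum>n<M. (c n - rat_complex (q n)) * taylor_coef f n)"
      by (simp add: rat_functional_def sum_subtractf left_diff_distrib)
    also have "\<dots> \<le> (\<Sum>n<M. \<delta> * (K n * nrm f))"
    proof (rule sum_norm_le)
      fix n
      show "cmod ((c n - rat_complex (q n)) * taylor_coef f n) \<le> \<delta> * (K n * nrm f)"
        unfolding norm_mult using q[of n] taylor_coef_bound[OF f, of n] \<delta>0
        by (intro mult_mono) (auto simp: K_def)
    qed
    also have "\<dots> = \<delta> * (\<Sum>n<M. K n) * nrm f" by (simp add: sum_distrib_left sum_distrib_right mult.assoc)
    also have "\<dots> \<le> e / 2 * nrm f" using \<delta>K norm_nonneg by (rule mult_right_mono)
    finally have "cmod ((\<Sum>n<M. c n * taylor_coef f n) - rat_functional (map q [0..<M]) f) \<le> e / 2 * nrm f" .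
    with c[OF f] show "cmod (\<psi> f - rat_functional (map q [0..<M]) f) \<le> e * nrm f"
      using norm_triangle_ineq[of "\<psi> f - (\<Sum>n<M. c n * taylor_coef f n)"
        "(\<Sum>n<M. c n * taylor_coef f n) - rat_functional (map q [0..<M]) f"] by simp
  qed
qed

section \<open>Monomials and their norms\<close>

text \<open>Coefficients of \<open>z ^ m\<close> in the basis \<open>fbasis\<close>.\<close>
definition mono_coef :: "nat \<Rightarrow> nat \<Rightarrow> complex" where
  "mono_coef m n = (if n < m then 0 else 1 / a m * (\<Prod>k<n - m. - (b (m + k) / a (m + k + 1))))"

lemma mono_coef_Suc: "m \<le> n \<Longrightarrow> mono_coef m (Suc n) = - (b n / a (Suc n)) * mono_coef m n"
  by (simp add: mono_coef_def Suc_diff_le mult.commute)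

text \<open>The recursion of \<open>mono_coef\<close> makes the contributions of \<open>a n\<close>
  and \<open>b (n - 1)\<close> cancel beyond \<open>m\<close>.\<close>

lemma ab_taylor_mono_coef: "ab_taylor a b (mono_coef m) n = (if n = m then 1 else 0)"
proof (cases n)
  case 0
  then show ?thesis using a_nz[of 0] by (auto simp: ab_taylor_def mono_coef_def)
next
  case (Suc k)
  consider "n < m" | "n = m" | "m \<le> k" using Suc by linarith
  then show ?thesis
  proof cases
    case 3
    then show ?thesis using Suc a_nz[of n] mono_coef_Suc[of m k] by (simp add: ab_taylor_def)
  qed (use Suc a_nz[of m] in \<open>auto simp: ab_taylor_def mono_coef_def\<close>)
qed

lemma norm_mono_coef:
  "cmod (mono_coef m (j + m)) = 1 / cmod (a m) * cmod (\<Prod>k<j. b (m + k) / a (m + k + 1))"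
  by (simp add: mono_coef_def norm_mult norm_divide prod_norm[symmetric])

text \<open>Entries below \<open>m\<close> vanish and \<open>1 / a m\<close> is a constant factor;
  splitting off the empty product \<open>j = 0\<close> leaves the series of the theorem, whose
  products start with one factor.\<close>

lemma mono_coef_in_lp_iff:
  "mono_coef m \<in> lp_seq p \<longleftrightarrow> summable (\<lambda>j. cmod (\<Prod>k<Suc j. b (m + k) / a (m + k + 1)) powr p)"
proof -
  let ?q = "\<lambda>j. cmod (\<Prod>k<j. b (m + k) / a (m + k + 1)) powr p"
  have "mono_coef m \<in> lp_seq p \<longleftrightarrow> summable (\<lambda>j. cmod (mono_coef m (j + m)) powr p)"
    unfolding lp_seq_def mem_Collect_eq by (rule summable_iff_shift[symmetric])
  also have "\<dots> \<longleftrightarrow> summable (\<lambda>j. (1 / cmod (a m)) powr p * ?q j)"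
    by (simp only: norm_mono_coef powr_mult)
  also have "\<dots> \<longleftrightarrow> summable ?q"
    using a_nz[of m] by (subst summable_cmult_iff) auto
  also have "\<dots> \<longleftrightarrow> summable (\<lambda>j. ?q (Suc j))" by (rule summable_Suc_iff[symmetric])
  finally show ?thesis .
qed

lemma lp_norm_mono_coef:
  assumes "mono_coef m \<in> lp_seq p"
  shows "lp_norm p (mono_coef m) = 1 / cmod (a m)
     * (1 + (\<Sum>j. cmod (\<Prod>k<Suc j. b (m + k) / a (m + k + 1)) powr p)) powr (1 / p)"
proof -
  let ?q = "\<lambda>j. cmod (\<Prod>k<j. b (m + k) / a (m + k + 1)) powr p"
  have qs: "summable (\<lambda>j. ?q (Suc j))" using assms unfolding mono_coef_in_lp_iff .
  then have q: "summable ?q" by (simp only: summable_Suc_iff[of ?q])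
  have s: "summable (\<lambda>n. cmod (mono_coef m n) powr p)" using assms by (simp add: lp_seq_def)
  have "(\<Sum>n. cmod (mono_coef m n) powr p)
      = (\<Sum>j. cmod (mono_coef m (j + m)) powr p) + (\<Sum>n<m. cmod (mono_coef m n) powr p)"
    using s by (rule suminf_split_initial_segment)
  also have "(\<Sum>n<m. cmod (mono_coef m n) powr p) = 0"
    by (rule sum.neutral) (simp add: mono_coef_def)
  also have "(\<Sum>j. cmod (mono_coef m (j + m)) powr p) = (1 / cmod (a m)) powr p * (\<Sum>j. ?q j)"
    unfolding norm_mono_coef powr_mult using q by (rule suminf_mult)
  also have "(\<Sum>j. ?q j) = (\<Sum>j. ?q (Suc j)) + ?q 0" using suminf_split_head[OF q] by linarith
  also have "?q 0 = 1" by simp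
  finally have eq: "(\<Sum>n. cmod (mono_coef m n) powr p) = (1 / cmod (a m)) powr p * (1 + (\<Sum>j. ?q (Suc j)))"
    by (simp only: add.commute add_0_right)
  have "((1 / cmod (a m)) powr p) powr (1 / p) = 1 / cmod (a m)"
    using p_pos a_nz[of m] by (simp add: powr_powr)
  then show ?thesis unfolding lp_norm_def eq powr_mult by simp
qed

lemma monomial_coef:
  assumes "f \<in> X" "\<And>n. taylor_coef f n = (if n = m then c else 0)"
  shows "coef f = (\<lambda>n. c * mono_coef m n)"
proof (rule ab_taylor_inj[where a = a and b = b])
  show "ab_taylor a b (coef f) = ab_taylor a b (\<lambda>n. c * mono_coef m n)"
  proof
    fix n
    have "ab_taylor a b (\<lambda>n. c * mono_coef m n) n = c * ab_taylor a b (mono_coef m) n"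
      by (simp add: ab_taylor_def algebra_simps split: nat.split)
    then show "ab_taylor a b (coef f) n = ab_taylor a b (\<lambda>n. c * mono_coef m n) n"
      using assms by (simp add: taylor_coef_eq[symmetric] ab_taylor_mono_coef)
  qed
qed (rule a_nz)

text \<open>Since \<open>c\<close> is nonzero, membership of \<open>f\<close> in \<open>X\<close>
  forces the coefficient sequence of the monomial into l^p.\<close>

lemma monomial_norm:
  assumes "f \<in> X" "\<And>n. taylor_coef f n = (if n = m then c else 0)" "c \<noteq> 0"
  shows "mono_coef m \<in> lp_seq p" "nrm f = cmod c * lp_norm p (mono_coef m)"
proof -
  have c: "coef f = (\<lambda>n. c * mono_coef m n)" using assms(1,2) by (rule monomial_coef)
  have "(\<lambda>n. 1 / c * coef f n) \<in> lp_seq p" using coef_props(1)[OF assms(1)] by (rule lp_seq_scale)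
  then show m: "mono_coef m \<in> lp_seq p" using assms(3) by (simp add: c)
  show "nrm f = cmod c * lp_norm p (mono_coef m)"
    unfolding norm_eq_lp_norm c using m p_pos by (rule lp_norm_scale)
qed

lemma taylor_coef_in_dual: "(\<lambda>f. if f \<in> X then c * taylor_coef f m else 0) \<in> dual"
  unfolding lpab_dual_def mem_Collect_eq
proof (intro conjI ballI allI impI exI)
  fix f assume f: "f \<in> X"
  then show "cmod (if f \<in> X then c * taylor_coef f m else 0)
      \<le> (cmod c * (cmod (a m) + cmod (b (m - 1)))) * nrm f"
    using mult_left_mono[OF taylor_coef_bound[OF f, of m], of "cmod c"] by (simp add: norm_mult mult_ac)
qed (auto simp: add_props scale_props taylor_coef_add taylor_coef_scale algebra_simps)

end

section \<open>The shift, its iterates and its adjoint\<close>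

locale lpab_shift = lpab_space +
  fixes w :: "nat \<Rightarrow> complex"
  assumes w_nz: "\<And>n. w n \<noteq> 0" and bdd: "fshift_bounded p a b w"
begin

abbreviation "F \<equiv> fshift a b w"
abbreviation "T \<equiv> fshift_adj p a b w"

text \<open>The scalar produced when \<open>n\<close> shifts carry \<open>z ^ m\<close> to
  \<open>z ^ (m + n)\<close>.\<close>

definition W :: "nat \<Rightarrow> nat \<Rightarrow> complex" where
  "W m n = (\<Prod>k<n. w (m + k))"

lemma W_nz: "W m n \<noteq> 0"
  using w_nz by (simp add: W_def)

lemma W_add: "W m (i + j) = W m i * W (m + i) j"
  by (induction j) (simp_all add: W_def mult_ac add.assoc)

lemma norm_W: "cmod (W m n) = (\<Prod>k<n. cmod (w (m + k)))"
  by (simp add: W_def prod_norm)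

lemma F_in: "f \<in> X \<Longrightarrow> F f \<in> X"
  using bdd by (simp add: fshift_bounded_def)

lemma F_taylor:
  assumes f: "f \<in> X"
  shows "taylor_coef (F f) n = (case n of 0 \<Rightarrow> 0 | Suc k \<Rightarrow> w k * taylor_coef f k)"
proof (rule taylor_coef_unique)
  fix z assume z: "z \<in> ab_disc a b"
  let ?u = "\<lambda>n. (case n of 0 \<Rightarrow> 0 | Suc k \<Rightarrow> w k * taylor_coef f k) * z ^ n"
  have "summable (\<lambda>n. taylor_coef f n * w n * z ^ Suc n)"
    using bdd f z by (simp add: fshift_bounded_def)
  then have "(\<lambda>n. taylor_coef f n * w n * z ^ Suc n) sums F f z"
    using z by (simp add: fshift_def summable_sums)
  moreover have "(\<lambda>n. taylor_coef f n * w n * z ^ Suc n) = (\<lambda>n. ?u (Suc n))"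
    by (simp add: mult_ac)
  ultimately show "?u sums F f z" using sums_Suc_iff[of ?u] by simp
qed

lemma F_scale: "f \<in> X \<Longrightarrow> F (\<lambda>z. c * f z) = (\<lambda>z. c * F f z)"
  by (rule lpab_eqI)
    (auto simp: F_in scale_props F_taylor taylor_coef_scale algebra_simps split: nat.split)

lemma Fn_in: "f \<in> X \<Longrightarrow> (F ^^ n) f \<in> X"
  by (induction n) (auto intro: F_in)

lemma Fn_scale: "f \<in> X \<Longrightarrow> (F ^^ n) (\<lambda>z. c * f z) = (\<lambda>z. c * (F ^^ n) f z)"
  by (induction n) (auto simp: F_scale Fn_in)

lemma Fn_taylor:
  assumes "f \<in> X"
  shows "taylor_coef ((F ^^ m) f) n = (if n < m then 0 else W (n - m) m * taylor_coef f (n - m))"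
proof (induction m arbitrary: n)
  case 0
  show ?case by (simp add: W_def)
next
  case (Suc m)
  have "taylor_coef ((F ^^ Suc m) f) n = (case n of 0 \<Rightarrow> 0 | Suc k \<Rightarrow> w k * taylor_coef ((F ^^ m) f) k)"
    using F_taylor[OF Fn_in[OF assms]] by simp
  then show ?case
    by (cases n) (auto simp: Suc.IH W_def mult_ac)
qed

lemma F_bound:
  obtains C where "1 \<le> C" "\<And>f. f \<in> X \<Longrightarrow> nrm (F f) \<le> C * nrm f"
proof -
  obtain C where C: "\<And>f. f \<in> X \<Longrightarrow> nrm (F f) \<le> C * nrm f"
    using bdd unfolding fshift_bounded_def by blast
  have "nrm (F f) \<le> max 1 C * nrm f" if "f \<in> X" for f
    using C[OF that] mult_right_mono[OF max.cobounded2[of C 1] norm_nonneg[of f]] by linarith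
  then show ?thesis using that[of "max 1 C"] by simp
qed

lemma Fn_bound:
  obtains C where "0 \<le> C" "\<And>f. f \<in> X \<Longrightarrow> nrm ((F ^^ n) f) \<le> C * nrm f"
proof -
  obtain C where C: "1 \<le> C" "\<And>f. f \<in> X \<Longrightarrow> nrm (F f) \<le> C * nrm f" by (rule F_bound) blast
  have "nrm ((F ^^ n) f) \<le> C ^ n * nrm f" if f: "f \<in> X" for f
  proof (induction n)
    case (Suc n)
    have "nrm ((F ^^ Suc n) f) \<le> C * nrm ((F ^^ n) f)" using C(2)[OF Fn_in[OF f]] by simp
    also have "\<dots> \<le> C * (C ^ n * nrm f)" using Suc C(1) by (intro mult_left_mono) auto
    finally show ?case by (simp add: mult_ac)
  qed simp
  then show ?thesis using that[of "C ^ n"] C(1) by simp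
qed

text \<open>Turns orbits of the adjoint into orbits of the shift. Already at \<open>n = 0\<close>
  this uses that dual elements are normalised to 0 off \<open>X\<close>.\<close>

lemma Tn_eq:
  assumes "\<phi> \<in> dual"
  shows "(T ^^ n) \<phi> f = (if f \<in> X then \<phi> ((F ^^ n) f) else 0)"
proof (induction n arbitrary: f)
  case 0
  show ?case using assms by (simp add: lpab_dual_def)
next
  case (Suc n)
  then show ?case by (simp add: fshift_adj_def F_in funpow_swap1)
qed

section \<open>Construction of supercyclic and hypercyclic functionals\<close>

text \<open>The \<open>n\<close>-th power of the adjoint maps the functional in \<open>small\<close>
  to \<open>c\<close> times the \<open>k\<close>-th Taylor functional, so \<open>small\<close> asks
  for small preimages, with one \<open>n\<close> for all \<open>k < L\<close>.
  \<open>S = {1}\<close> gives hypercyclicity, all nonzero scalars give supercyclicity.\<close>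

lemma exists_cyclic_functional:
  assumes S0: "0 \<notin> S"
    and small: "\<And>L m e. 0 < e \<Longrightarrow> \<exists>n\<ge>m. \<exists>c\<in>S. \<forall>k<L. \<forall>f\<in>X.
        cmod (c * taylor_coef f (k + n) / W k n) \<le> e * nrm f"
  obtains \<phi> where "\<phi> \<in> dual"
    "\<And>\<psi> e. \<psi> \<in> dual \<Longrightarrow> 0 < e \<Longrightarrow>
       \<exists>n. \<exists>c\<in>S. \<forall>f\<in>X. cmod (\<phi> ((F ^^ n) f) - c * \<psi> f) \<le> cmod c * e * nrm f"
proof -
  \<comment> \<open>Pair coding lists every rational functional at infinitely many indices, so that
    the accuracy \<open>(1 / 2) ^ j\<close> can be improved for a fixed target.\<close>
  define y :: "nat \<Rightarrow> (complex \<Rightarrow> complex) \<Rightarrow> complex"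
    where "y j = rat_functional (from_nat (fst (prod_decode j)))" for j
  \<comment> \<open>Linearity passes to the pointwise sum; the bound on the sum will come from the
    geometric estimate on the terms.\<close>
  define Z where "Z = {v. (\<forall>f\<in>X. \<forall>g\<in>X. v (\<lambda>z. f z + g z) = v f + v g)
     \<and> (\<forall>c. \<forall>f\<in>X. v (\<lambda>z. c * f z) = c * v f) \<and> (\<exists>m. \<forall>n\<ge>m. \<forall>f\<in>X. v ((F ^^ n) f) = (0::complex))}"
  obtain C where C: "1 \<le> C" "\<And>f. f \<in> X \<Longrightarrow> nrm (F f) \<le> C * nrm f" by (rule F_bound) blast
  have sel: "\<exists>n\<ge>m. \<exists>v\<in>Z. \<exists>c\<in>S. (\<forall>f\<in>X. v ((F ^^ n) f) = c * y j f) \<and> (\<forall>f\<in>X. cmod (v f) \<le> e * nrm f)"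
    if e: "0 < e" for j m e
  proof -
    define d :: "(rat \<times> rat) list" where "d = from_nat (fst (prod_decode j))"
    define q where "q k = rat_complex (d ! k)" for k
    define D where "D = (\<Sum>k<length d. cmod (q k)) + 1"
    have D: "0 < D" unfolding D_def by (intro add_nonneg_pos sum_nonneg) auto
    have "0 < e / D" using e D by simp
    from small[OF this, of m "length d"] obtain n c where nc: "m \<le> n" "c \<in> S"
      "\<And>k f. k < length d \<Longrightarrow> f \<in> X \<Longrightarrow> cmod (c * taylor_coef f (k + n) / W k n) \<le> e / D * nrm f"
      by blast
    define v where "v f = (\<Sum>k<length d. q k * (c * taylor_coef f (k + n) / W k n))" for f
    \<comment> \<open>\<open>v\<close> sees only Taylor coefficients of index below
      \<open>length d + n\<close>, and \<open>i\<close> shifts clear all indices below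
      \<open>i\<close>.\<close>
    have "v ((F ^^ i) f) = 0" if "length d + n \<le> i" "f \<in> X" for i f
      unfolding v_def using that by (intro sum.neutral) (simp add: Fn_taylor)
    then have "v \<in> Z" unfolding Z_def
      by (auto simp: v_def taylor_coef_add taylor_coef_scale sum.distrib[symmetric] sum_distrib_left
        intro!: sum.cong) (auto simp: field_simps add_divide_distrib)
    moreover have "v ((F ^^ n) f) = c * y j f" if "f \<in> X" for f
      unfolding v_def y_def rat_functional_def d_def[symmetric] q_def sum_distrib_left
      using W_nz that by (intro sum.cong) (auto simp: Fn_taylor)
    moreover have "cmod (v f) \<le> e * nrm f" if f: "f \<in> X" for f
    proof -
      have "cmod (v f) \<le> (\<Sum>k<length d. cmod (q k) * (e / D * nrm f))"
        unfolding v_def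
      proof (rule sum_norm_le)
        fix k assume "k \<in> {..<length d}"
        then have "cmod (c * taylor_coef f (k + n) / W k n) \<le> e / D * nrm f" using nc(3) f by simp
        then show "cmod (q k * (c * taylor_coef f (k + n) / W k n)) \<le> cmod (q k) * (e / D * nrm f)"
          unfolding norm_mult[of "q k"] by (rule mult_left_mono) simp
      qed
      also have "\<dots> = (D - 1) * (e / D * nrm f)"
        unfolding sum_distrib_right[symmetric] by (simp add: D_def)
      also have "\<dots> \<le> D * (e / D * nrm f)"
        using e D norm_nonneg[of f] by (intro mult_right_mono mult_nonneg_nonneg) auto
      also have "\<dots> = e * nrm f" using D by simp
      finally show ?thesis .
    qed
    ultimately show ?thesis using nc(1,2) by blast
  qed
  obtain v n c where v: "\<And>j. v j \<in> Z" "\<And>j f. f \<in> X \<Longrightarrow> cmod (v j f) \<le> (1 / 2) ^ j * nrm f"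
    "\<And>j. c j \<in> S"
    "\<And>j f. f \<in> X \<Longrightarrow>
       cmod ((\<Sum>i. v i ((F ^^ n j) f)) - c j * y j f) \<le> cmod (c j) * (1 / 2) ^ j * nrm f"
    by (rule series_orbit_approximation[where X = X and N = nrm and F = F and C = C and Z = Z and S = S and y = y])
      (use F_in norm_nonneg C S0 sel in \<open>auto simp: Z_def\<close>)
  have geo: "(\<lambda>j. (1 / 2) ^ j * nrm f) sums (2 * nrm f)" for f
    using sums_mult2[OF geometric_sums[of "1 / 2 :: real"]] by simp
  have summ: "summable (\<lambda>j. v j f)" if "f \<in> X" for f
    by (rule summable_comparison_test'[OF sums_summable[OF geo[of f]]]) (use v(2) that in auto)
  define \<phi> where "\<phi> f = (if f \<in> X then \<Sum>j. v j f else 0)" for f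
  have "\<phi> \<in> dual"
    unfolding lpab_dual_def mem_Collect_eq
  proof (intro conjI ballI allI impI exI)
    fix f g assume f: "f \<in> X" and g: "g \<in> X"
    have "v j (\<lambda>z. f z + g z) = v j f + v j g" for j using v(1)[of j] f g by (simp add: Z_def)
    then show "\<phi> (\<lambda>z. f z + g z) = \<phi> f + \<phi> g"
      using f g by (simp add: \<phi>_def add_props suminf_add summ)
  next
    fix c f assume f: "f \<in> X"
    have "v j (\<lambda>z. c * f z) = c * v j f" for j using v(1)[of j] f by (simp add: Z_def)
    then show "\<phi> (\<lambda>z. c * f z) = c * \<phi> f"
      using f by (simp add: \<phi>_def scale_props suminf_mult summ)
  next
    fix f assume f: "f \<in> X"
    have "cmod (\<Sum>j. v j f) \<le> (\<Sum>j. (1 / 2) ^ j * nrm f)"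
      using v(2)[OF f] sums_summable[OF geo] by (rule norm_suminf_le)
    then show "cmod (\<phi> f) \<le> 2 * nrm f" using f sums_unique[OF geo[of f]] by (simp add: \<phi>_def)
  qed (simp add: \<phi>_def)
  moreover have "\<exists>n. \<exists>c\<in>S. \<forall>f\<in>X. cmod (\<phi> ((F ^^ n) f) - c * \<psi> f) \<le> cmod c * e * nrm f"
    if \<psi>: "\<psi> \<in> dual" and e: "0 < e" for \<psi> e
  proof -
    obtain d where d: "\<And>f. f \<in> X \<Longrightarrow> cmod (\<psi> f - rat_functional d f) \<le> e / 2 * nrm f"
      using dual_rat_approx[OF \<psi> half_gt_zero[OF e]] by blast
    obtain K :: nat where K: "(1 / 2) ^ K < e / 2"
      using real_arch_pow_inv[of "e / 2" "1 / 2"] e by auto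
    \<comment> \<open>A code is at least its second component, so \<open>K \<le> j\<close> and index
      \<open>j\<close> is accurate enough.\<close>
    define j where "j = prod_encode (to_nat d, K)"
    have yj: "y j = rat_functional d" by (simp add: y_def j_def)
    have "(1 / 2 :: real) ^ j \<le> (1 / 2) ^ K"
      by (rule power_decreasing) (auto simp: j_def le_prod_encode_2)
    then have j2: "(1 / 2) ^ j \<le> e / 2" using K by linarith
    have "cmod (\<phi> ((F ^^ n j) f) - c j * \<psi> f) \<le> cmod (c j) * e * nrm f" if f: "f \<in> X" for f
    proof -
      have "\<phi> ((F ^^ n j) f) - c j * \<psi> f
          = ((\<Sum>i. v i ((F ^^ n j) f)) - c j * y j f) - c j * (\<psi> f - rat_functional d f)"
        using Fn_in[OF f] by (simp add: \<phi>_def yj algebra_simps)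
      then have "cmod (\<phi> ((F ^^ n j) f) - c j * \<psi> f)
          \<le> cmod ((\<Sum>i. v i ((F ^^ n j) f)) - c j * y j f) + cmod (c j * (\<psi> f - rat_functional d f))"
        by (simp only: norm_triangle_ineq4)
      also have "\<dots> \<le> cmod (c j) * (1 / 2) ^ j * nrm f + cmod (c j) * (e / 2 * nrm f)"
        unfolding norm_mult using v(4)[OF f] d[OF f] by (intro add_mono mult_left_mono) auto
      also have "\<dots> \<le> cmod (c j) * (e / 2) * nrm f + cmod (c j) * (e / 2 * nrm f)"
        using j2 norm_nonneg[of f] by (intro add_mono mult_right_mono mult_left_mono) auto
      finally show ?thesis by (simp add: mult_ac)
    qed
    then show ?thesis using v(3)[of j] by blast
  qed
  ultimately show ?thesis using that by blast
qed

lemma supercyclic: "adj_supercyclic p a b w"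
proof -
  let ?S = "UNIV - {0} :: complex set"
  have small: "\<exists>n\<ge>m. \<exists>c\<in>?S. \<forall>k<L. \<forall>f\<in>X. cmod (c * taylor_coef f (k + n) / W k n) \<le> e * nrm f"
    if e: "0 < e" for L m e
  proof -
    define K where "K k = (cmod (a (k + m)) + cmod (b (k + m - 1))) / cmod (W k m)" for k
    have K0: "0 \<le> K k" for k by (simp add: K_def)
    define D where "D = (\<Sum>k<L. K k) + 1"
    have D: "0 < D" unfolding D_def by (intro add_nonneg_pos sum_nonneg K0) auto
    \<comment> \<open>A scalar this small makes the index \<open>m\<close> itself work:
      \<open>D\<close> exceeds every \<open>K k\<close>, the norm bound of the \<open>k\<close>-th
      functional before scaling.\<close>
    let ?c = "of_real (e / D) :: complex"
    have "cmod (?c * taylor_coef f (k + m) / W k m) \<le> e * nrm f" if k: "k < L" and f: "f \<in> X" for k f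
    proof -
      have "K k \<le> (\<Sum>k<L. K k)" using k K0 by (intro member_le_sum) auto
      then have KD: "K k \<le> D" by (simp add: D_def)
      have "cmod (taylor_coef f (k + m)) / cmod (W k m) \<le> K k * nrm f"
        unfolding K_def times_divide_eq_left using taylor_coef_bound[OF f] by (intro divide_right_mono) auto
      also have "K k * nrm f \<le> D * nrm f" using KD norm_nonneg by (rule mult_right_mono)
      finally have "e / D * (cmod (taylor_coef f (k + m)) / cmod (W k m)) \<le> e / D * (D * nrm f)"
        using e D by (intro mult_left_mono) auto
      moreover have "cmod (?c * taylor_coef f (k + m) / W k m)
          = e / D * (cmod (taylor_coef f (k + m)) / cmod (W k m))"
        using e D by (simp add: norm_mult norm_divide)
      ultimately show ?thesis using D by simp
    qed
    moreover have "?c \<in> ?S" using e D by simp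
    ultimately show ?thesis by blast
  qed
  obtain \<phi> where \<phi>: "\<phi> \<in> dual" "\<And>\<psi> e. \<psi> \<in> dual \<Longrightarrow> 0 < e \<Longrightarrow>
       \<exists>n. \<exists>c\<in>?S. \<forall>f\<in>X. cmod (\<phi> ((F ^^ n) f) - c * \<psi> f) \<le> cmod c * e * nrm f"
    by (rule exists_cyclic_functional[of ?S]) (use small in auto)
  have "\<exists>n c. dual_dist p a b (\<lambda>f. c * (T ^^ n) \<phi> f) \<psi> < e" if \<psi>: "\<psi> \<in> dual" and e: "0 < e" for \<psi> e
  proof -
    obtain n c where c: "c \<noteq> 0"
      "\<And>f. f \<in> X \<Longrightarrow> cmod (\<phi> ((F ^^ n) f) - c * \<psi> f) \<le> cmod c * (e / 2) * nrm f"
      using \<phi>(2)[OF \<psi> half_gt_zero[OF e]] by auto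
    \<comment> \<open>The error is relative to \<open>cmod c\<close>, so dividing by
      \<open>c\<close> restores an absolute bound.\<close>
    have "dual_dist p a b (\<lambda>f. 1 / c * (T ^^ n) \<phi> f) \<psi> \<le> e / 2"
    proof (rule dual_dist_le)
      fix f assume f: "f \<in> X"
      have "1 / c * (T ^^ n) \<phi> f - \<psi> f = (\<phi> ((F ^^ n) f) - c * \<psi> f) / c"
        using c(1) f by (simp add: Tn_eq[OF \<phi>(1)] field_simps)
      then show "cmod (1 / c * (T ^^ n) \<phi> f - \<psi> f) \<le> e / 2 * nrm f"
        using c(2)[OF f] c(1) by (simp add: norm_divide field_simps)
    qed (use e in simp)
    then show ?thesis using e by (intro exI[of _ n] exI[of _ "1 / c"]) simp
  qed
  then show ?thesis unfolding adj_supercyclic_def using \<phi>(1) by blast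
qed

lemma hypercyclicI:
  assumes "\<And>\<nu>. liminf (\<lambda>n. ereal ((cmod (a (\<nu> + n)) + cmod (b (\<nu> + n - 1)))
                      / (\<Prod>k<n. cmod (w (\<nu> + k))))) = 0"
  shows "adj_hypercyclic p a b w"
proof -
  have small: "\<exists>n\<ge>m. \<exists>c\<in>{1::complex}. \<forall>k<L. \<forall>f\<in>X. cmod (c * taylor_coef f (k + n) / W k n) \<le> e * nrm f"
    if e: "0 < e" for L m e
  proof -
    have "\<forall>i. \<exists>C\<ge>0. \<forall>f\<in>X. nrm ((F ^^ i) f) \<le> C * nrm f" using Fn_bound by metis
    from choice[OF this] obtain C where C: "\<And>i. 0 \<le> C i"
      "\<And>i f. f \<in> X \<Longrightarrow> nrm ((F ^^ i) f) \<le> C i * nrm f" by blast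
    \<comment> \<open>Cost of carrying index \<open>k\<close> up to \<open>L\<close>: a norm bound
      for \<open>L - k\<close> shifts, divided by the weights they pick up.\<close>
    define A where "A k = C (L - k) / cmod (W k (L - k))" for k
    have A0: "0 \<le> A k" for k using C(1) by (simp add: A_def)
    define D where "D = (\<Sum>k<L. A k) + 1"
    have D: "0 < D" unfolding D_def by (intro add_nonneg_pos sum_nonneg A0) auto
    have "\<forall>e>0. \<forall>m. \<exists>n\<ge>m. (cmod (a (L + n)) + cmod (b (L + n - 1))) / cmod (W L n) < e"
      using assms[of L] unfolding norm_W by (subst (asm) liminf_ereal_eq_0_iff) (auto intro!: divide_nonneg_nonneg prod_nonneg)
    moreover have "0 < e / D" using e D by simp
    ultimately obtain n where n: "m \<le> n" "(cmod (a (L + n)) + cmod (b (L + n - 1))) / cmod (W L n) < e / D"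
      by blast
    have "cmod (1 * taylor_coef f (k + n) / W k n) \<le> e * nrm f" if k: "k < L" and f: "f \<in> X" for k f
    proof -
      define i where "i = L - k"
      have L: "L = k + i" using k by (simp add: i_def)
      let ?K = "cmod (a (L + n)) + cmod (b (L + n - 1))"
      \<comment> \<open>The functional on the left is a fixed multiple of the image under \<open>T ^^ i\<close> of the one with
          \<open>k = L\<close>; hence smallness for \<open>L\<close> alone gives one \<open>n\<close> that works for all \<open>k < L\<close>.\<close>
      have "taylor_coef ((F ^^ i) f) (L + n) = W (k + n) i * taylor_coef f (k + n)"
        using Fn_taylor[OF f, of i "L + n"] by (simp add: L)
      then have "taylor_coef f (k + n) / W k n = taylor_coef ((F ^^ i) f) (L + n) / (W k n * W (k + n) i)"
        using W_nz by (simp add: field_simps)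
      \<comment> \<open>Both sides split \<open>W k (n + i)\<close>, once after \<open>n\<close> and
        once after \<open>i\<close> factors.\<close>
      also have "W k n * W (k + n) i = W k i * W L n"
        using W_add[of k n i] W_add[of k i n] by (simp add: L add.commute)
      finally have "cmod (1 * taylor_coef f (k + n) / W k n)
          = cmod (taylor_coef ((F ^^ i) f) (L + n)) / (cmod (W k i) * cmod (W L n))"
        by (simp add: norm_divide norm_mult)
      also have "\<dots> \<le> (?K * (C i * nrm f)) / (cmod (W k i) * cmod (W L n))"
      proof (rule divide_right_mono)
        have "cmod (taylor_coef ((F ^^ i) f) (L + n)) \<le> ?K * nrm ((F ^^ i) f)"
          using taylor_coef_bound[OF Fn_in[OF f]] .
        also have "\<dots> \<le> ?K * (C i * nrm f)" using C(2)[OF f] by (intro mult_left_mono) auto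
        finally show "cmod (taylor_coef ((F ^^ i) f) (L + n)) \<le> ?K * (C i * nrm f)" .
      qed simp
      also have "\<dots> = ?K / cmod (W L n) * (A k * nrm f)" by (simp add: A_def i_def)
      also have "\<dots> \<le> e / D * (D * nrm f)"
      proof (intro mult_mono)
        have "A k \<le> (\<Sum>k<L. A k)" using k A0 by (intro member_le_sum) auto
        then show "A k \<le> D" by (simp add: D_def)
      qed (use n(2) e D A0 norm_nonneg in auto)
      also have "\<dots> = e * nrm f" using D by simp
      finally show ?thesis .
    qed
    then show ?thesis using n(1) by blast
  qed
  obtain \<phi> where \<phi>: "\<phi> \<in> dual" "\<And>\<psi> e. \<psi> \<in> dual \<Longrightarrow> 0 < e \<Longrightarrow>
       \<exists>n. \<exists>c\<in>{1}. \<forall>f\<in>X. cmod (\<phi> ((F ^^ n) f) - c * \<psi> f) \<le> cmod c * e * nrm f"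
    by (rule exists_cyclic_functional[of "{1}"]) (use small in auto)
  have "\<exists>n. dual_dist p a b ((T ^^ n) \<phi>) \<psi> < e" if \<psi>: "\<psi> \<in> dual" and e: "0 < e" for \<psi> e
  proof -
    obtain n where n: "\<And>f. f \<in> X \<Longrightarrow> cmod (\<phi> ((F ^^ n) f) - \<psi> f) \<le> e / 2 * nrm f"
      using \<phi>(2)[OF \<psi> half_gt_zero[OF e]] by auto
    have "dual_dist p a b ((T ^^ n) \<phi>) \<psi> \<le> e / 2"
      using e n by (intro dual_dist_le) (auto simp: Tn_eq[OF \<phi>(1)])
    then show ?thesis using e by (intro exI[of _ n]) simp
  qed
  then show ?thesis unfolding adj_hypercyclic_def hypercyclic_on_def using \<phi>(1) by blast
qed

section \<open>Necessary conditions from unbounded orbits\<close>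

text \<open>If the norms along the orbit of \<open>f\<close> were at most \<open>B\<close>, every
  functional in the orbit of \<open>\<phi>\<close> would be at most \<open>C * B\<close> at
  \<open>f\<close>; but one of them must be close to a functional \<open>\<psi>\<close> with value
  \<open>C * B + 1\<close> there. The nonzero Taylor coefficient provides
  \<open>\<psi>\<close>.\<close>

lemma hypercyclic_orbit_unbounded:
  assumes hc: "adj_hypercyclic p a b w" and f: "f \<in> X" and m: "taylor_coef f m \<noteq> 0"
  shows "\<exists>n. B < nrm ((F ^^ n) f)"
proof (rule ccontr)
  assume "\<not> ?thesis"
  then have B: "nrm ((F ^^ n) f) \<le> B" for n by (simp add: not_less)
  obtain \<phi> where \<phi>: "\<phi> \<in> dual" "\<And>\<psi> e. \<psi> \<in> dual \<Longrightarrow> 0 < e \<Longrightarrow> \<exists>n. dual_dist p a b ((T ^^ n) \<phi>) \<psi> < e"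
    using hc unfolding adj_hypercyclic_def hypercyclic_on_def by blast
  obtain C where C: "0 \<le> C" "\<And>f. f \<in> X \<Longrightarrow> cmod (\<phi> f) \<le> C * nrm f" using dual_bound[OF \<phi>(1)] by blast
  let ?c = "of_real (C * B + 1) / taylor_coef f m"
  define \<psi> where "\<psi> = (\<lambda>f. if f \<in> X then ?c * taylor_coef f m else 0)"
  have \<psi>: "\<psi> \<in> dual" unfolding \<psi>_def by (rule taylor_coef_in_dual)
  obtain C' where C': "0 \<le> C'" "\<And>f. f \<in> X \<Longrightarrow> cmod (\<psi> f) \<le> C' * nrm f" using dual_bound[OF \<psi>] by blast
  \<comment> \<open>Makes the error at \<open>f\<close> itself less than 1.\<close>
  define e where "e = 1 / (nrm f + 1)"
  have e: "0 < e" using norm_nonneg[of f] by (simp add: e_def)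
  obtain n where n: "dual_dist p a b ((T ^^ n) \<phi>) \<psi> < e" using \<phi>(2)[OF \<psi> e] by blast
  obtain C'' where C'': "0 \<le> C''" "\<And>f. f \<in> X \<Longrightarrow> nrm ((F ^^ n) f) \<le> C'' * nrm f" by (rule Fn_bound) blast
  have "cmod ((T ^^ n) \<phi> f - \<psi> f) \<le> e * nrm f"
  proof (rule dual_dist_lessD[OF n _ _ _ f])
    fix c g assume g: "g \<in> X"
    have sc: "\<phi> (\<lambda>z. c * h z) = c * \<phi> h" "\<psi> (\<lambda>z. c * h z) = c * \<psi> h" if "h \<in> X" for h
      using \<phi>(1) \<psi> that unfolding lpab_dual_def by blast+
    show "(T ^^ n) \<phi> (\<lambda>z. c * g z) - \<psi> (\<lambda>z. c * g z) = c * ((T ^^ n) \<phi> g - \<psi> g)"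
      using g sc(1)[OF Fn_in[OF g]] sc(2)[OF g]
      by (simp add: Tn_eq[OF \<phi>(1)] scale_props Fn_scale right_diff_distrib)
  next
    fix g assume g: "g \<in> X"
    have "cmod ((T ^^ n) \<phi> g - \<psi> g) \<le> cmod (\<phi> ((F ^^ n) g)) + cmod (\<psi> g)"
      using g by (simp add: Tn_eq[OF \<phi>(1)] norm_triangle_ineq4)
    also have "\<dots> \<le> C * (C'' * nrm g) + C' * nrm g"
      using C(2)[OF Fn_in[OF g]] mult_left_mono[OF C''(2)[OF g] C(1)] C'(2)[OF g] by (meson add_mono order_trans)
    finally show "cmod ((T ^^ n) \<phi> g - \<psi> g) \<le> (C * C'' + C') * nrm g" by (simp add: algebra_simps)
  qed (use C C' C'' in simp)
  also have "\<dots> < 1" using norm_nonneg[of f] by (simp add: e_def field_simps)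
  finally have "cmod (\<phi> ((F ^^ n) f) - \<psi> f) < 1" using f by (simp add: Tn_eq[OF \<phi>(1)])
  moreover have CB: "cmod (\<phi> ((F ^^ n) f)) \<le> C * B"
    using C(2)[OF Fn_in[OF f]] mult_left_mono[OF B C(1)] by (meson order_trans)
  moreover have "0 \<le> C * B" using CB norm_ge_zero order_trans by blast
  moreover have "\<psi> f = of_real (C * B + 1)" using f m by (simp add: \<psi>_def)
  then have "cmod (\<psi> f) = \<bar>C * B + 1\<bar>" by (simp only: norm_of_real)
  moreover have "cmod (\<psi> f) \<le> cmod (\<phi> ((F ^^ n) f)) + cmod (\<phi> ((F ^^ n) f) - \<psi> f)"
    using norm_triangle_sub[of "\<psi> f" "\<phi> ((F ^^ n) f)"] by (simp add: norm_minus_commute)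
  ultimately show False by linarith
qed

lemma Fn_monomial:
  assumes f: "f \<in> X" "\<And>n. taylor_coef f n = (if n = m then 1 else 0)"
  shows "mono_coef (m + n) \<in> lp_seq p" "nrm ((F ^^ n) f) = cmod (W m n) * lp_norm p (mono_coef (m + n))"
proof -
  have "taylor_coef ((F ^^ n) f) k = (if k = m + n then W m n else 0)" for k
    using Fn_taylor[OF f(1), of n k] f(2)[of "k - n"] by auto
  from monomial_norm[OF Fn_in[OF f(1)] this W_nz]
  show "mono_coef (m + n) \<in> lp_seq p" "nrm ((F ^^ n) f) = cmod (W m n) * lp_norm p (mono_coef (m + n))" .
qed

lemma hypercyclic_imp_SUP:
  assumes hc: "adj_hypercyclic p a b w" and one: "(\<lambda>z. if z \<in> ab_disc a b then 1 else 0) \<in> X"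
  shows "(SUP n. if summable (\<lambda>j. cmod (\<Prod>k<Suc j. b (n + k) / a (n + k + 1)) powr p)
                  then ereal ((\<Prod>k<n. cmod (w k)) / cmod (a n)
                       * (1 + (\<Sum>j. cmod (\<Prod>k<Suc j. b (n + k) / a (n + k + 1)) powr p)) powr (1 / p))
                  else \<infinity>) = \<infinity>" (is "(SUP n. ?t n) = \<infinity>")
proof -
  define f :: "complex \<Rightarrow> complex" where "f = (\<lambda>z. if z \<in> ab_disc a b then 1 else 0)"
  have f: "f \<in> X" using one by (simp add: f_def)
  have tc: "taylor_coef f n = (if n = 0 then 1 else 0)" for n
  proof (rule taylor_coef_unique)
    fix z assume z: "z \<in> ab_disc a b"
    have "(\<lambda>n. if n = 0 then z ^ n else 0) sums z ^ 0" by (rule sums_single)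
    then show "(\<lambda>n. (if n = 0 then 1 else 0) * z ^ n) sums f z"
      using z by (simp add: f_def if_distrib[of "\<lambda>x. x * _"] cong: if_cong)
  qed
  \<comment> \<open>The terms of the supremum are the norms along the orbit of the constant 1; as
    the orbit stays in \<open>X\<close>, each series converges and the finite branch is
    taken.\<close>
  have t: "?t n = ereal (nrm ((F ^^ n) f))" for n
    using Fn_monomial[OF f tc, of n] lp_norm_mono_coef[of n] mono_coef_in_lp_iff[of n]
    by (simp add: norm_W)
  show ?thesis
  proof (rule ccontr)
    assume "(SUP n. ?t n) \<noteq> \<infinity>"
    moreover have "?t 0 \<le> (SUP n. ?t n)" by (rule SUP_upper) simp
    then have "(SUP n. ?t n) \<noteq> - \<infinity>" unfolding t by auto
    ultimately obtain B where B: "(SUP n. ?t n) = ereal B" by (cases "SUP n. ?t n") auto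
    obtain n where "B < nrm ((F ^^ n) f)"
      using hypercyclic_orbit_unbounded[OF hc f, of 0 B] tc by auto
    moreover have "?t n \<le> (SUP n. ?t n)" by (rule SUP_upper) simp
    then have "nrm ((F ^^ n) f) \<le> B" unfolding B unfolding t by simp
    ultimately show False by simp
  qed
qed

text \<open>The ratios are eventually at most some \<open>r < 1\<close>, so monomials lie in the
  space and, for large \<open>m\<close>, \<open>z ^ m\<close> has norm at most a constant times
  \<open>1 / cmod (a m)\<close>. An unbounded orbit of \<open>z ^ \<nu>\<close> then forces
  \<open>W \<nu> n / a (\<nu> + n)\<close> to be unbounded.\<close>

lemma hypercyclic_imp_liminf:
  assumes hc: "adj_hypercyclic p a b w" and lim: "limsup (\<lambda>n. ereal (cmod (b n / a (Suc n)))) < 1"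
  shows "liminf (\<lambda>n. ereal (cmod (a (\<nu> + n) / (\<Prod>k<n. w (\<nu> + k))))) = 0"
proof -
  obtain r' where r': "limsup (\<lambda>n. ereal (cmod (b n / a (Suc n)))) < ereal r'" "ereal r' < 1"
    using ereal_dense2[OF lim] by blast
  \<comment> \<open>The maximum with \<open>1 / 2\<close> keeps \<open>r\<close> positive for the
    laws of \<open>powr\<close>.\<close>
  define r where "r = max r' (1 / 2)"
  have r: "0 < r" "r < 1" using r'(2) by (auto simp: r_def one_ereal_def)
  obtain M where M: "\<And>n. M \<le> n \<Longrightarrow> cmod (b n / a (Suc n)) \<le> r"
    using Limsup_lessD[OF r'(1)] by (force simp: eventually_sequentially r_def)
  have rp: "0 < r powr p" "r powr p < 1" using r p_pos powr_less_mono2[of p r 1] by auto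
  have lp: "mono_coef m \<in> lp_seq p" for m
  proof -
    have "summable (\<lambda>n. cmod (mono_coef m n) powr p)"
    proof (rule summable_ratio_test[of "r powr p" "max M m"])
      fix n assume n: "max M m \<le> n"
      have "cmod (mono_coef m (Suc n)) \<le> r * cmod (mono_coef m n)"
        using mono_coef_Suc[of m n] mult_right_mono[OF M[of n] norm_ge_zero[of "mono_coef m n"]] n
        by (simp add: norm_mult norm_divide)
      then have "cmod (mono_coef m (Suc n)) powr p \<le> (r * cmod (mono_coef m n)) powr p"
        using p_pos by (intro powr_mono2) auto
      then show "norm (cmod (mono_coef m (Suc n)) powr p) \<le> r powr p * norm (cmod (mono_coef m n) powr p)"
        using r by (simp add: powr_mult)
    qed (rule rp)
    then show ?thesis by (simp add: lp_seq_def)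
  qed
  \<comment> \<open>Geometric majorant, uniform in \<open>m \<ge> M\<close>, of the factor next to
    \<open>1 / cmod (a m)\<close> in \<open>lp_norm_mono_coef\<close>.\<close>
  define D where "D = (1 + (\<Sum>j. (r powr p) ^ Suc j)) powr (1 / p)"
  have gs: "summable (\<lambda>j. (r powr p) ^ Suc j)"
    using rp by (subst summable_Suc_iff) (auto intro: summable_geometric)
  have "0 \<le> (\<Sum>j. (r powr p) ^ Suc j)" using gs by (rule suminf_nonneg) simp
  then have D: "0 < D" by (simp add: D_def)
  have bound: "lp_norm p (mono_coef m) \<le> D / cmod (a m)" if m: "M \<le> m" for m
  proof -
    let ?q = "\<lambda>j. cmod (\<Prod>k<Suc j. b (m + k) / a (m + k + 1)) powr p"
    have q: "summable ?q" using lp[of m] unfolding mono_coef_in_lp_iff .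
    have le: "?q j \<le> (r powr p) ^ Suc j" for j
    proof -
      have "cmod (\<Prod>k<Suc j. b (m + k) / a (m + k + 1)) = (\<Prod>k<Suc j. cmod (b (m + k) / a (m + k + 1)))"
        by (rule prod_norm[symmetric])
      also have "\<dots> \<le> (\<Prod>k<Suc j. r)" using M m by (intro prod_mono) auto
      finally have "cmod (\<Prod>k<Suc j. b (m + k) / a (m + k + 1)) \<le> r ^ Suc j" by simp
      then have "?q j \<le> (r ^ Suc j) powr p" using p_pos by (intro powr_mono2) auto
      also have "\<dots> = (r powr p) ^ Suc j"
        using r by (simp add: powr_realpow[symmetric] powr_powr mult.commute del: power_Suc)
      finally show ?thesis .
    qed
    have "0 \<le> suminf ?q" using q by (rule suminf_nonneg) simp
    then have "(1 + suminf ?q) powr (1 / p) \<le> D"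
      unfolding D_def using suminf_le[OF le q gs] p_pos by (intro powr_mono2) auto
    then show ?thesis unfolding lp_norm_mono_coef[OF lp] by (simp add: divide_right_mono)
  qed
  define f where "f = synth (mono_coef \<nu>)"
  have f: "f \<in> X" "\<And>n. taylor_coef f n = (if n = \<nu> then 1 else 0)"
    using synth[OF lp] by (simp_all add: f_def taylor_coef_eq ab_taylor_mono_coef)
  have "\<exists>n\<ge>m. cmod (a (\<nu> + n) / W \<nu> n) < e" if e: "0 < e" for e m
  proof -
    \<comment> \<open>Adding the first \<open>m + M\<close> norms forces any index whose norm
      exceeds \<open>B\<close> to be late.\<close>
    define B where "B = D / e + (\<Sum>n<m + M. nrm ((F ^^ n) f))"
    obtain n where n: "B < nrm ((F ^^ n) f)"
      using hypercyclic_orbit_unbounded[OF hc f(1), of \<nu> B] f(2) by auto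
    have s0: "0 \<le> (\<Sum>n<m + M. nrm ((F ^^ n) f))" by (intro sum_nonneg norm_nonneg)
    have nm: "m + M \<le> n"
    proof (rule ccontr)
      assume "\<not> ?thesis"
      then have "nrm ((F ^^ n) f) \<le> (\<Sum>n<m + M. nrm ((F ^^ n) f))"
        by (intro member_le_sum norm_nonneg) auto
      moreover have "0 \<le> D / e" using D e by simp
      ultimately show False using n by (simp add: B_def)
    qed
    have "D / e < nrm ((F ^^ n) f)" using n s0 by (simp add: B_def)
    also have "\<dots> = cmod (W \<nu> n) * lp_norm p (mono_coef (\<nu> + n))" by (rule Fn_monomial(2)[OF f])
    also have "\<dots> \<le> cmod (W \<nu> n) * (D / cmod (a (\<nu> + n)))"
      using bound[of "\<nu> + n"] nm by (intro mult_left_mono) auto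
    finally have "D * cmod (a (\<nu> + n)) < D * (e * cmod (W \<nu> n))"
      using e a_nz[of "\<nu> + n"] by (simp add: field_simps)
    then have "cmod (a (\<nu> + n) / W \<nu> n) < e"
      using D W_nz[of \<nu> n] by (simp add: norm_divide divide_less_eq)
    then show ?thesis using nm by (intro exI[of _ n]) simp
  qed
  then show ?thesis unfolding W_def[symmetric] by (subst liminf_ereal_eq_0_iff) auto
qed

text \<open>Eventually \<open>b (n - 1)\<close> is dominated by \<open>a n\<close>, so the numerator
  in \<open>hypercyclicI\<close> is at most twice \<open>cmod (a (\<nu> + n))\<close>.\<close>

lemma hypercyclicI_ratio:
  assumes lim: "limsup (\<lambda>n. ereal (cmod (b n / a (Suc n)))) < 1"
    and inf: "\<And>\<nu>. liminf (\<lambda>n. ereal (cmod (a (\<nu> + n) / (\<Prod>k<n. w (\<nu> + k))))) = 0"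
  shows "adj_hypercyclic p a b w"
proof (rule hypercyclicI)
  fix \<nu>
  obtain M where M: "\<And>n. M \<le> n \<Longrightarrow> cmod (b n / a (Suc n)) < 1"
    using Limsup_lessD[OF lim] by (auto simp: eventually_sequentially one_ereal_def)
  have "\<exists>n\<ge>m. (cmod (a (\<nu> + n)) + cmod (b (\<nu> + n - 1))) / cmod (W \<nu> n) < e" if e: "0 < e" for e m
  proof -
    have "\<forall>e>0. \<forall>m. \<exists>n\<ge>m. cmod (a (\<nu> + n) / W \<nu> n) < e"
      using inf[of \<nu>] unfolding W_def by (subst (asm) liminf_ereal_eq_0_iff) auto
    \<comment> \<open>The extra 1 makes \<open>\<nu> + n - 1\<close> a true predecessor, and
      \<open>e / 2\<close> pays for the factor 2.\<close>
    then obtain n where n: "m + M + 1 \<le> n" "cmod (a (\<nu> + n) / W \<nu> n) < e / 2"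
      using half_gt_zero[OF e] by blast
    then have "M \<le> \<nu> + n - 1" "Suc (\<nu> + n - 1) = \<nu> + n" by auto
    then have "cmod (b (\<nu> + n - 1)) \<le> cmod (a (\<nu> + n))"
      using M[of "\<nu> + n - 1"] a_nz[of "\<nu> + n"] by (simp add: norm_divide)
    then have "(cmod (a (\<nu> + n)) + cmod (b (\<nu> + n - 1))) / cmod (W \<nu> n) \<le> 2 * cmod (a (\<nu> + n)) / cmod (W \<nu> n)"
      by (intro divide_right_mono) auto
    also have "\<dots> < e" using n(2) by (simp add: norm_divide mult.commute)
    finally show ?thesis using n(1) by (intro exI[of _ n]) simp
  qed
  then show "liminf (\<lambda>n. ereal ((cmod (a (\<nu> + n)) + cmod (b (\<nu> + n - 1)))
                      / (\<Prod>k<n. cmod (w (\<nu> + k))))) = 0"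
    unfolding norm_W[symmetric] by (subst liminf_ereal_eq_0_iff) auto
qed

end

theorem mainTheorem4:
  fixes p :: real and a b w :: "nat \<Rightarrow> complex"
  assumes p: "1 < p"
    and a_nz: "\<And>n. a n \<noteq> 0" and b_nz: "\<And>n. b n \<noteq> 0"
    and growth: "ab_rho a b < \<infinity>"
    and w_nz: "\<And>n. w n \<noteq> 0"
    and bdd: "fshift_bounded p a b w"
  shows
    "((\<forall>\<nu>. liminf (\<lambda>n. ereal ((cmod (a (\<nu> + n)) + cmod (b (\<nu> + n - 1)))
                      / (\<Prod>k<n. cmod (w (\<nu> + k))))) = 0)
        \<longrightarrow> adj_hypercyclic p a b w)
   \<and> ((adj_hypercyclic p a b w \<and> (\<lambda>z. if z \<in> ab_disc a b then 1 else 0) \<in> lpab p a b)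
        \<longrightarrow> (SUP n. if summable (\<lambda>j. cmod (\<Prod>k<Suc j. b (n + k) / a (n + k + 1)) powr p)
                  then ereal ((\<Prod>k<n. cmod (w k)) / cmod (a n)
                       * (1 + (\<Sum>j. cmod (\<Prod>k<Suc j. b (n + k) / a (n + k + 1)) powr p)) powr (1 / p))
                  else \<infinity>) = \<infinity>)
   \<and> adj_supercyclic p a b w
   \<and> ((bdd_above (range (\<lambda>n. cmod (w n * a n / a (Suc n))))
        \<and> limsup (\<lambda>n. ereal (cmod (b n / a (Suc n)))) < 1)
        \<longrightarrow> (adj_hypercyclic p a b w \<longleftrightarrow>
             (\<forall>\<nu>. liminf (\<lambda>n. ereal (cmod (a (\<nu> + n) / (\<Prod>k<n. w (\<nu> + k))))) = 0)))"
proof -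
  interpret lpab_shift p a b w
    using p a_nz growth w_nz bdd by unfold_locales
  show ?thesis
    by (intro conjI impI allI iffI; (elim conjE)?)
      (rule hypercyclicI hypercyclic_imp_SUP supercyclic hypercyclic_imp_liminf hypercyclicI_ratio; blast)+
qed

end
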